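(* Let $k\ge 2$ be an integer and $p\in(0,1)$ with $kp>1$. Let $E\subset[0,1]^2$ be the percolation fractal with parameters $k,p$ and let $\mu$ be its natural measure. Then, almost surely on the event that $E$ is nonempty, the following hold simultaneously. (1) For every $\theta\in[0,\pi)$ the projected measure $\mu^\theta=\pi_\theta^*\mu$ is absolutely continuous with respect to Lebesgue measure on $\mathbb R$. (2) For every $\theta\in[0,\pi)\setminus\{0,\pi/2\}$ the density of $\mu^\theta$ is Hölder continuous. (3) For $\theta\in\{0,\pi/2\}$ the density of $\mu^\theta$ (which need not be defined at the $k$-adic points) is Hölder continuous with respect to the metric $\rho$ on the set of all points of $[0,1]$ that are not $k$-adic, where for $x<y$ $$\rho(x,y)=\exp\bigl(-\log k\cdot\min\{\ell:\ \exists\, m\ \ x<mk^{-\ell}<y\}\bigr)$$ (with $\ell$ a nonnegative integer and $m$ an integer), $\rho(y,x)=\rho(x,y)$ and $\rho(x,x)=0$.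
   Context: Percolation fractal: for $\underline i_n=(i_1,\dots,i_n)\in\{0,\dots,k-1\}^n$ put $I_{\underline i_n}=\left[\sum_{\ell=1}^n i_\ell k^{-\ell},\,k^{-n}+\sum_{\ell=1}^n i_\ell k^{-\ell}\right]$ and $K_{\underline i_n,\underline j_n}=I_{\underline i_n}\times I_{\underline j_n}$. Random sets $\mathcal E_n\subset\{0,\dots,k-1\}^n\times\{0,\dots,k-1\}^n$ are defined inductively: each $(i,j)\in\{0,\dots,k-1\}^2$ belongs to $\mathcal E_1$ with probability $p$, independently; given $\mathcal E_n$, for each $(\underline i_n,\underline j_n)\in\mathcal E_n$ and each $(i,j)\in\{0,\dots,k-1\}^2$ the pair $(\underline i_n i,\underline j_n j)$ belongs to $\mathcal E_{n+1}$ with probability $p$, all these events being mutually independent; and $(\underline i_n i,\underline j_n j)\notin\mathcal E_{n+1}$ if $(\underline i_n,\underline j_n)\notin\mathcal E_n$. Put $E_n=\bigcup_{(\underline i_n,\underline j_n)\in\mathcal E_n}K_{\underline i_n,\underline j_n}$ and $E=\bigcap_n E_n$. The limit $Z(E)=\lim_{n\to\infty}(k^2p)^{-n}\,\sharp\mathcal E_n$ exists and is finite almost surely, and is almost surely positive if $E\neq\emptyset$. The natural measure is the weak limit $\mu=\lim_{n\to\infty}\frac{1}{p^nZ(E)}\mathrm{Leb}|_{E_n}$, which exists almost surely on $\{E\ne\emptyset\}$; it is a known fact that these limits exist. For $\theta\in[0,\pi)$, $\pi_\theta(x,y)=x\cos\theta+y\sin\theta$, and $\pi_\theta^*\mu$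 denotes the image (push-forward) of $\mu$ under $\pi_\theta$. A $k$-adic point is a number $mk^{-\ell}$ with integers $m$ and $\ell\ge0$. "The density is Hölder continuous" means that the density has a version with this property; Hölder exponent and constant may depend on $\theta$ and on the realization. *)

theory Defs
  imports "HOL-Probability.Probability"
begin

section \<open>Cells coded by pairs of words\<close>

text \<open>
  A cell of generation \<open>n\<close> is coded by a pair of words of length \<open>n\<close> over \<open>{0..<k}\<close>.
  The list index starts at \<open>0\<close>, so the digit \<open>w ! l\<close> has weight \<open>k\<close> to the power \<open>- (l + 1)\<close>.
\<close>

type_synonym code = "nat list \<times> nat list"

definition left_end :: "nat \<Rightarrow> nat list \<Rightarrow> real" where
  "left_end k w = (\<Sum>l<length w. real (w ! l) / real k ^ Suc l)"

definition adic_interval :: "nat \<Rightarrow> nat list \<Rightarrow> real set" where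
  "adic_interval k w = {left_end k w .. 1 / real k ^ length w + left_end k w}"

definition cell :: "nat \<Rightarrow> code \<Rightarrow> (real \<times> real) set" where
  "cell k c = adic_interval k (fst c) \<times> adic_interval k (snd c)"

definition children :: "nat \<Rightarrow> code set \<Rightarrow> code set" where
  "children k A = {(u @ [i], v @ [j]) | u v i j. (u, v) \<in> A \<and> i < k \<and> j < k}"

section \<open>The percolation process\<close>

text \<open>
  \<open>S n\<close> is the random set of retained codes of generation \<open>n\<close>. Starting from the pair of
  empty words at generation \<open>0\<close> makes the rule for generation \<open>1\<close> an instance of the rule
  for the inductive step. \<open>Given the first n generations\<close> is conditioning on an event
  \<open>S 0 = A 0, \<dots>, S n = A n\<close> of positive probability: under the conditional measure the
  events that the individual children are retained are independent of probability \<open>p\<close>.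
  The whole history is needed, since \<open>S n\<close> forgets earlier cells without descendants.
\<close>

locale fractal_percolation = prob_space M for M :: "'w measure" +
  fixes k :: nat and p :: real and S :: "nat \<Rightarrow> 'w \<Rightarrow> code set"
  assumes retained_event: "\<And>n c. {\<omega> \<in> space M. c \<in> S n \<omega>} \<in> events"
    and start: "\<And>\<omega>. \<omega> \<in> space M \<Longrightarrow> S 0 \<omega> = {([], [])}"
    and step: "\<And>n \<omega>. \<omega> \<in> space M \<Longrightarrow> S (Suc n) \<omega> \<subseteq> children k (S n \<omega>)"
    and retained_prob:
      "\<And>n A H c. H = {\<omega> \<in> space M. \<forall>m\<le>n. S m \<omega> = A m} \<Longrightarrow> prob H > 0 \<Longrightarrow>
         c \<in> children k (A n) \<Longrightarrow>
         measure (uniform_measure M H) {\<omega> \<in> space M. c \<in> S (Suc n) \<omega>} = p"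
    and retained_indep:
      "\<And>n A H. H = {\<omega> \<in> space M. \<forall>m\<le>n. S m \<omega> = A m} \<Longrightarrow> prob H > 0 \<Longrightarrow>
         prob_space.indep_events (uniform_measure M H)
           (\<lambda>c. {\<omega> \<in> space M. c \<in> S (Suc n) \<omega>}) (children k (A n))"

text \<open>In the following, \<open>s\<close> is one realization \<open>\<lambda>n. S n \<omega>\<close> of the process.\<close>

definition generation_set :: "nat \<Rightarrow> (nat \<Rightarrow> code set) \<Rightarrow> nat \<Rightarrow> (real \<times> real) set" where
  "generation_set k s n = (\<Union>c\<in>s n. cell k c)"

definition percolation_fractal :: "nat \<Rightarrow> (nat \<Rightarrow> code set) \<Rightarrow> (real \<times> real) set" where
  "percolation_fractal k s = (\<Inter>n. generation_set k s n)"

section \<open>The natural measure\<close>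

definition percolation_Z :: "nat \<Rightarrow> real \<Rightarrow> (nat \<Rightarrow> code set) \<Rightarrow> real" where
  "percolation_Z k p s = lim (\<lambda>n. real (card (s n)) / (real k ^ 2 * p) ^ n)"

definition natural_approx ::
    "nat \<Rightarrow> real \<Rightarrow> (nat \<Rightarrow> code set) \<Rightarrow> nat \<Rightarrow> (real \<times> real) measure" where
  "natural_approx k p s n =
     density lborel
       (\<lambda>z. ennreal (1 / (p ^ n * percolation_Z k p s)) * indicator (generation_set k s n) z)"

text \<open>
  The notion of weak convergence in HOL-Probability is restricted to probability measures on
  the real line, whereas the measures here live in the plane and are merely finite.
\<close>

definition weak_limit :: "(nat \<Rightarrow> 'a::topological_space measure) \<Rightarrow> 'a measure \<Rightarrow> bool" where
  "weak_limit N \<nu> \<longleftrightarrow> sets \<nu> = sets borel \<and> finite_measure \<nu> \<and>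
     (\<forall>f :: 'a \<Rightarrow> real. continuous_on UNIV f \<and> bounded (range f) \<longrightarrow>
        (\<lambda>n. \<integral>z. f z \<partial>N n) \<longlonglongrightarrow> (\<integral>z. f z \<partial>\<nu>))"

definition is_natural_measure ::
    "nat \<Rightarrow> real \<Rightarrow> (nat \<Rightarrow> code set) \<Rightarrow> (real \<times> real) measure \<Rightarrow> bool" where
  "is_natural_measure k p s \<mu> \<longleftrightarrow> weak_limit (natural_approx k p s) \<mu>"

section \<open>Projections, densities and Hoelder continuity\<close>

definition proj :: "real \<Rightarrow> real \<times> real \<Rightarrow> real" where
  "proj \<theta> z = fst z * cos \<theta> + snd z * sin \<theta>"

definition projected :: "real \<Rightarrow> (real \<times> real) measure \<Rightarrow> real measure" where
  "projected \<theta> \<mu> = distr \<mu> borel (proj \<theta>)"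

definition is_density :: "real measure \<Rightarrow> (real \<Rightarrow> real) \<Rightarrow> bool" where
  "is_density \<nu> f \<longleftrightarrow> f \<in> borel_measurable borel \<and> (\<forall>x. 0 \<le> f x) \<and>
     \<nu> = density lborel (\<lambda>x. ennreal (f x))"

definition holder_on :: "('a \<Rightarrow> 'a \<Rightarrow> real) \<Rightarrow> 'a set \<Rightarrow> ('a \<Rightarrow> real) \<Rightarrow> bool" where
  "holder_on d A f \<longleftrightarrow>
     (\<exists>C \<alpha>. 0 < \<alpha> \<and> \<alpha> \<le> 1 \<and> (\<forall>x\<in>A. \<forall>y\<in>A. \<bar>f x - f y\<bar> \<le> C * d x y powr \<alpha>))"

definition adic_points :: "nat \<Rightarrow> real set" where
  "adic_points k = {of_int m / real k ^ l | (m :: int) (l :: nat). True}"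

text \<open>
  For distinct points and \<open>k \<ge> 2\<close> the set whose least element is taken is nonempty, because
  the \<open>k\<close>-adic points are dense.
\<close>

definition adic_dist :: "nat \<Rightarrow> real \<Rightarrow> real \<Rightarrow> real" where
  "adic_dist k x y =
     (if x = y then 0
      else exp (- ln (real k) *
        real (LEAST l. \<exists>m::int. min x y < of_int m / real k ^ l \<and> of_int m / real k ^ l < max x y)))"

end

theory Submission imports Defs begin

text \<open>
  Let \<open>X n L\<close> be \<open>p ^ (- n)\<close> times the length of the trace of the line \<open>L\<close> on the generation \<open>n\<close> set.
  Given the first \<open>n\<close> generations, \<open>X (n + 1) L - X n L\<close> is a centred sum of independent terms, and
  Hoeffding's inequality bounds the probability that it exceeds \<open>r ^ n * max 1 (X n L)\<close> by
  \<open>2 * exp (- c * (r ^ 2 * k * p) ^ n)\<close>. With \<open>r = (k * p) powr (- 1 / 4)\<close> this decays doubly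
  exponentially, whereas a grid of exponentially many lines suffices at generation \<open>n\<close>, because the
  trace is Lipschitz in the line with an exponentially growing constant (parallel to an axis, there are
  only \<open>k ^ n\<close> different traces anyway). By Borel-Cantelli,
  \<open>X n\<close> converges almost surely at a geometric rate, uniformly in the line. The limit is, up to a
  constant, the density of the projected measure, and the rate together with the Lipschitz bounds (or
  the constancy on \<open>k\<close>-adic intervals) yields Hoelder continuity.
\<close>

section \<open>Concentration of the increments\<close>

text \<open>No bound on \<open>X n L\<close> is known in advance, and the variance of its next
  increment is controlled only by a multiple of \<open>X n L\<close> itself. The deviation is
  therefore measured relative to \<open>max 1 (X n L)\<close>, which makes the tail bound uniform in
  the history; boundedness is recovered afterwards, because the factors \<open>1 + r ^ n\<close>
  have a convergent product. The exponent has a simple source: a cell of generation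
  \<open>n + 1\<close> contributes at most \<open>k ^ - (n + 1)\<close> to a trace whose scale is
  \<open>p ^ n\<close>, so such a trace averages about \<open>(k * p) ^ n\<close> independent terms.
  Deviations of order \<open>r ^ n\<close> become rare once \<open>r ^ 2 * k * p > 1\<close>, and
  \<open>k * p > 1\<close> leaves room for such an \<open>r < 1\<close>. The mean of the increment
  must vanish exactly, also for lines running along cell edges, hence the half-open cells. Once a
  null set is discarded, everything concerns one fixed realization. The natural measure enters only
  through weak convergence tested against continuous functions of the projection, so one null set
  serves all directions and all weak limits.\<close>

text \<open>A family with the single member \<open>A i\<close> is stable under intersection, so
  independence of the events passes to the sigma-algebras they generate, and the weighted indicators
  are measurable with respect to these.\<close>

lemma (in prob_space) indep_vars_weighted_indicator:
  fixes w :: "'i \<Rightarrow> real"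
  assumes "indep_events A I"
  shows "indep_vars (\<lambda>_. borel) (\<lambda>i \<omega>. w i * indicator (A i) \<omega>) I"
proof -
  have A: "A i \<in> events" if "i \<in> I" for i
    using assms that by (auto simp: indep_events_def)
  have "indep_sets (\<lambda>i. {A i}) I"
    using assms by (simp add: indep_events_def_alt)
  then have "indep_sets (\<lambda>i. sigma_sets (space M) {A i}) I"
    by (intro indep_sets_sigma) (auto simp: Int_stable_def)
  moreover have "{(\<lambda>\<omega>. w i * indicator (A i) \<omega>) -` B \<inter> space M | B. B \<in> sets borel}
      \<subseteq> sigma_sets (space M) {A i}" if "i \<in> I" for i
  proof -
    have sub: "{A i} \<subseteq> Pow (space M)"
      using A[OF that] sets.sets_into_space by auto
    have "A i \<in> sets (sigma (space M) {A i})"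
      using sub by (simp add: sigma_sets.Basic)
    then have "(\<lambda>\<omega>. w i * indicator (A i) \<omega>) \<in> borel_measurable (sigma (space M) {A i})"
      by measurable
    then show ?thesis
      using sub by (auto dest: measurable_sets)
  qed
  ultimately have "indep_sets (\<lambda>i. {(\<lambda>\<omega>. w i * indicator (A i) \<omega>) -` B \<inter> space M | B. B \<in> sets borel}) I"
    by (rule indep_sets_mono_sets)
  moreover have "random_variable borel (\<lambda>\<omega>. w i * indicator (A i) \<omega>)" if "i \<in> I" for i
    using A[OF that] by measurable
  ultimately show ?thesis
    by (simp add: indep_vars_def2)
qed

lemma (in prob_space) hoeffding_weighted_indicators:
  fixes w :: "'i \<Rightarrow> real"
  assumes "finite I" and indep: "indep_events A I" and p: "\<And>i. i \<in> I \<Longrightarrow> prob (A i) = p"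
    and w: "\<And>i. i \<in> I \<Longrightarrow> 0 \<le> w i" and V: "(\<Sum>i\<in>I. (w i)\<^sup>2) \<le> V" "0 < V" and "0 \<le> e"
  shows "prob {\<omega> \<in> space M. e < \<bar>(\<Sum>i\<in>I. w i * indicator (A i) \<omega>) - p * (\<Sum>i\<in>I. w i)\<bar>}
    \<le> 2 * exp (- 2 * e\<^sup>2 / V)"
proof -
  let ?X = "\<lambda>i \<omega>. w i * indicator (A i) \<omega> :: real"
  have A: "A i \<in> events" if "i \<in> I" for i
    using indep that by (auto simp: indep_events_def)
  have meas [measurable]: "?X i \<in> borel_measurable M" if "i \<in> I" for i
    using A[OF that] by measurable
  have E: "(\<Sum>i\<in>I. expectation (?X i)) = p * (\<Sum>i\<in>I. w i)"
    unfolding sum_distrib_left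
  proof (rule sum.cong)
    fix i assume "i \<in> I"
    then show "expectation (?X i) = p * w i"
      using A[of i] p[of i] by simp
  qed simp
  show ?thesis
  proof (cases "(\<Sum>i\<in>I. (w i)\<^sup>2) > 0")
    case True
    interpret Hoeffding_ineq M I ?X "\<lambda>_. 0" w "p * (\<Sum>i\<in>I. w i)"
      by unfold_locales
        (use assms E indep_vars_weighted_indicator in \<open>auto simp: indicator_def\<close>)
    have "prob {\<omega> \<in> space M. e < \<bar>(\<Sum>i\<in>I. ?X i \<omega>) - p * (\<Sum>i\<in>I. w i)\<bar>}
        \<le> prob {\<omega> \<in> space M. e \<le> \<bar>(\<Sum>i\<in>I. ?X i \<omega>) - p * (\<Sum>i\<in>I. w i)\<bar>}"
      by (intro finite_measure_mono) auto
    also have "\<dots> \<le> 2 * exp (- 2 * e\<^sup>2 / (\<Sum>i\<in>I. (w i - 0)\<^sup>2))"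
      using True \<open>0 \<le> e\<close> by (intro Hoeffding_ineq_abs_ge) auto
    also have "\<dots> \<le> 2 * exp (- 2 * e\<^sup>2 / V)"
      using True V by (auto intro!: divide_left_mono mult_pos_pos)
    finally show ?thesis .
  next
    \<comment> \<open>Here all weights vanish and the deviation is identically \<open>0\<close>, so
      the strict inequality defining the event fails.\<close>
    case False
    then have "(\<Sum>i\<in>I. (w i)\<^sup>2) = 0"
      by (simp add: antisym sum_nonneg not_less)
    then have "w i = 0" if "i \<in> I" for i
      using \<open>finite I\<close> that by (simp add: sum_nonneg_eq_0_iff)
    then have "{\<omega> \<in> space M. e < \<bar>(\<Sum>i\<in>I. ?X i \<omega>) - p * (\<Sum>i\<in>I. w i)\<bar>} = {}"
      using \<open>0 \<le> e\<close> by auto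
    then show ?thesis
      by (metis exp_ge_zero measure_empty mult_nonneg_nonneg zero_le_numeral)
  qed
qed

text \<open>The law of total probability over the finitely many values of \<open>f\<close>. Fibres
  of probability zero contribute nothing, so a conditional bound is required only where conditioning
  makes sense.\<close>

lemma (in prob_space) prob_le_of_fibres:
  assumes fin: "finite (f ` space M)" and B: "B \<in> events"
    and f: "\<And>h. {\<omega> \<in> space M. f \<omega> = h} \<in> events"
    and le: "\<And>h. prob {\<omega> \<in> space M. f \<omega> = h} > 0 \<Longrightarrow>
      prob (B \<inter> {\<omega> \<in> space M. f \<omega> = h}) \<le> b * prob {\<omega> \<in> space M. f \<omega> = h}"
  shows "prob B \<le> b"
proof -
  let ?H = "\<lambda>h. {\<omega> \<in> space M. f \<omega> = h}"
  have le': "prob (B \<inter> ?H h) \<le> b * prob (?H h)" for h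
  proof (cases "prob (?H h) > 0")
    case False
    then have "prob (?H h) = 0"
      using measure_nonneg[of M "?H h"] by linarith
    moreover have "prob (B \<inter> ?H h) \<le> prob (?H h)"
      using f by (intro finite_measure_mono) auto
    ultimately show ?thesis by simp
  qed (rule le)
  have "prob B = prob (\<Union>h\<in>f ` space M. B \<inter> ?H h)"
    using sets.sets_into_space[OF B] by (intro arg_cong[where f = prob]) auto
  also have "\<dots> = (\<Sum>h\<in>f ` space M. prob (B \<inter> ?H h))"
    using fin f B by (intro finite_measure_finite_Union) (auto simp: disjoint_family_on_def)
  also have "\<dots> \<le> (\<Sum>h\<in>f ` space M. b * prob (?H h))"
    by (intro sum_mono le')
  also have "\<dots> = b * prob (\<Union>h\<in>f ` space M. ?H h)"
    unfolding sum_distrib_left[symmetric] using fin f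
    by (subst finite_measure_finite_Union) (auto simp: disjoint_family_on_def)
  also have "(\<Union>h\<in>f ` space M. ?H h) = space M"
    by auto
  finally show ?thesis
    by (simp add: prob_space)
qed

section \<open>Codes of one generation and events determined by them\<close>

definition codes :: "nat \<Rightarrow> nat \<Rightarrow> code set" where
  "codes k n = {(u, v). length u = n \<and> length v = n \<and> set u \<subseteq> {..<k} \<and> set v \<subseteq> {..<k}}"

lemma codes_eq: "codes k n = {u. set u \<subseteq> {..<k} \<and> length u = n} \<times> {u. set u \<subseteq> {..<k} \<and> length u = n}"
  by (auto simp: codes_def)

lemma finite_codes [simp]: "finite (codes k n)"
  by (simp add: codes_eq finite_lists_length_eq)

lemma card_codes: "card (codes k n) = (k ^ n)\<^sup>2"
  by (simp add: codes_eq card_cartesian_product card_lists_length_eq power2_eq_square)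

lemma children_mono: "A \<subseteq> B \<Longrightarrow> children k A \<subseteq> children k B"
  by (fastforce simp: children_def)

lemma children_codes: "children k (codes k n) \<subseteq> codes k (Suc n)"
  by (auto simp: children_def codes_def)

lemma children_subset_codes: "A \<subseteq> codes k n \<Longrightarrow> children k A \<subseteq> codes k (Suc n)"
  using children_mono children_codes by blast

context fractal_percolation
begin

lemma retained_subset_codes: "\<omega> \<in> space M \<Longrightarrow> S n \<omega> \<subseteq> codes k n"
proof (induction n)
  case 0
  then show ?case by (simp add: start codes_def)
next
  case (Suc n)
  then show ?case
    using step[OF Suc.prems, of n] children_subset_codes by blast
qed

lemma retained_eq_event [measurable]: "{\<omega> \<in> space M. S n \<omega> = A} \<in> events"
proof (cases "A \<subseteq> codes k n")
  case True
  have "{\<omega> \<in> space M. S n \<omega> = A} = {\<omega> \<in> space M. \<forall>c\<in>codes k n. c \<in> S n \<omega> \<longleftrightarrow> c \<in> A}"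
    using True retained_subset_codes by blast
  also have "\<dots> \<in> events"
    using retained_event by (intro sets.sets_Collect_finite_All sets.sets_Collect) auto
  finally show ?thesis .
next
  case False
  then have "{\<omega> \<in> space M. S n \<omega> = A} = {}"
    using retained_subset_codes by auto
  then show ?thesis by (metis sets.empty_sets)
qed

lemma history_event: "{\<omega> \<in> space M. \<forall>m\<le>n. S m \<omega> = A m} \<in> events"
proof -
  have "{\<omega> \<in> space M. \<forall>m\<in>{..n}. S m \<omega> = A m} \<in> events"
    by (intro sets.sets_Collect_finite_All retained_eq_event) auto
  then show ?thesis by (simp add: atMost_def)
qed

text \<open>\<open>S n\<close> and \<open>S m\<close> take only finitely many values, so the event
  is a finite union of atoms, whatever the predicate \<open>Q\<close> is.\<close>

lemma retained_pair_event: "{\<omega> \<in> space M. Q (S n \<omega>) (S m \<omega>)} \<in> events"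
proof -
  have "{\<omega> \<in> space M. Q (S n \<omega>) (S m \<omega>)} =
    (\<Union>a\<in>Pow (codes k n). \<Union>b\<in>{b \<in> Pow (codes k m). Q a b}.
      {\<omega> \<in> space M. S n \<omega> = a} \<inter> {\<omega> \<in> space M. S m \<omega> = b})"
    using retained_subset_codes by (auto; blast)
  also have "\<dots> \<in> events"
    by (intro sets.finite_UN sets.Int retained_eq_event) auto
  finally show ?thesis .
qed

text \<open>
  The squares of the weights sum to at most \<open>s\<close> times their sum, so measuring the deviation relative
  to that sum gives a tail bound that does not depend on the history.
\<close>

lemma increment_tail_given_history:
  fixes w :: "code \<Rightarrow> real"
  assumes "0 < p" "0 \<le> \<epsilon>" "0 < s" and w: "\<And>c. 0 \<le> w c" "\<And>c. w c \<le> s"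
    and \<omega>0: "\<omega>0 \<in> space M" and H: "H = {\<omega> \<in> space M. \<forall>m\<le>n. S m \<omega> = S m \<omega>0}" and pos: "prob H > 0"
    and B: "B = {\<omega> \<in> space M. \<epsilon> * p * max (p ^ n) (\<Sum>c\<in>children k (S n \<omega>). w c)
      < \<bar>(\<Sum>c\<in>S (Suc n) \<omega>. w c) - p * (\<Sum>c\<in>children k (S n \<omega>). w c)\<bar>}"
  shows "prob (B \<inter> H) \<le> 2 * exp (- 2 * \<epsilon>\<^sup>2 * p ^ (n + 2) / s) * prob H"
proof -
  define I where "I = children k (S n \<omega>0)"
  define Y where "Y = (\<Sum>c\<in>I. w c)"
  define m where "m = max (p ^ n) Y"
  \<comment> \<open>On \<open>H\<close> the candidate set is the fixed set \<open>I\<close>, so the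
    sum over the random set \<open>S (Suc n)\<close> can be written as a sum over \<open>I\<close>
    with indicators, the form that Hoeffding's inequality takes. On \<open>H\<close>, the event
    \<open>B\<close> implies \<open>B'\<close>.\<close>
  define B' where "B' = {\<omega> \<in> space M. \<epsilon> * p * m
    < \<bar>(\<Sum>c\<in>I. w c * indicator {\<omega> \<in> space M. c \<in> S (Suc n) \<omega>} \<omega>) - p * (\<Sum>c\<in>I. w c)\<bar>}"
  have I: "I \<subseteq> codes k (Suc n)" "finite I"
    unfolding I_def using children_subset_codes[OF retained_subset_codes[OF \<omega>0]]
      finite_subset[OF _ finite_codes] by blast+
  have H_ev: "H \<in> events"
    unfolding H by (rule history_event)
  have [measurable]: "{\<omega> \<in> space M. c \<in> S (Suc n) \<omega>} \<in> events" for c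
    by (rule retained_event)
  have B'_ev: "B' \<in> events"
    unfolding B'_def by measurable
  have m: "0 < m" "p ^ n \<le> m" "Y \<le> m"
    using \<open>0 < p\<close> by (auto simp: m_def less_max_iff_disj)
  let ?U = "uniform_measure M H"
  have eH: "emeasure M H = ennreal (prob H)"
    by (simp add: emeasure_eq_measure)
  interpret U: prob_space ?U
    using pos by (intro prob_space_uniform_measure) (auto simp: eH)
  have V: "(\<Sum>c\<in>I. (w c)\<^sup>2) \<le> s * m"
  proof -
    have "(\<Sum>c\<in>I. (w c)\<^sup>2) \<le> (\<Sum>c\<in>I. s * w c)"
      using w by (intro sum_mono) (auto simp: power2_eq_square intro: mult_right_mono)
    also have "\<dots> = s * Y"
      by (simp add: Y_def sum_distrib_left)
    finally show ?thesis
      using m \<open>0 < s\<close> by (meson mult_le_cancel_left_pos order_trans)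
  qed
  \<comment> \<open>The squared deviation is quadratic in \<open>m\<close>, the bound
    \<open>s * m\<close> on the sum of squared weights only linear; the surviving factor
    \<open>m\<close> is at least \<open>p ^ n\<close>.\<close>
  have "measure ?U B' \<le> 2 * exp (- 2 * (\<epsilon> * p * m)\<^sup>2 / (s * m))"
    unfolding B'_def space_uniform_measure[of M H, symmetric]
    apply (intro U.hoeffding_weighted_indicators)
    using retained_prob[OF H pos] retained_indep[OF H pos] I w V m assms by (auto simp: I_def)
  also have "\<dots> \<le> 2 * exp (- 2 * \<epsilon>\<^sup>2 * p ^ (n + 2) / s)"
  proof -
    have "2 * \<epsilon>\<^sup>2 * p ^ (n + 2) / s = 2 * \<epsilon>\<^sup>2 * p\<^sup>2 / s * p ^ n"
      by (simp add: power2_eq_square)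
    also have "\<dots> \<le> 2 * \<epsilon>\<^sup>2 * p\<^sup>2 / s * m"
      using m \<open>0 < s\<close> by (intro mult_left_mono) auto
    also have "\<dots> = 2 * (\<epsilon> * p * m)\<^sup>2 / (s * m)"
      using m by (simp add: power2_eq_square)
    finally show ?thesis by simp
  qed
  finally have "measure ?U B' \<le> 2 * exp (- 2 * \<epsilon>\<^sup>2 * p ^ (n + 2) / s)" .
  moreover have "measure ?U B' = prob (H \<inter> B') / prob H"
    using pos B'_ev by (intro measure_uniform_measure) (auto simp: eH)
  moreover have "prob (B \<inter> H) \<le> prob (H \<inter> B')"
  proof (intro finite_measure_mono subsetI)
    fix \<omega> assume "\<omega> \<in> B \<inter> H"
    then have \<omega>: "\<omega> \<in> space M" "S n \<omega> = S n \<omega>0" "\<omega> \<in> B" "\<omega> \<in> H"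
      by (auto simp: H)
    have "S (Suc n) \<omega> \<subseteq> I"
      using step[OF \<omega>(1), of n] \<omega>(2) by (simp add: I_def)
    then have "(\<Sum>c\<in>I. w c * indicator {\<omega> \<in> space M. c \<in> S (Suc n) \<omega>} \<omega>) = (\<Sum>c\<in>S (Suc n) \<omega>. w c)"
      using \<open>finite I\<close> \<omega>(1) by (intro sum.mono_neutral_cong_right) auto
    then show "\<omega> \<in> H \<inter> B'"
      using \<omega> by (auto simp: B B'_def I_def m_def Y_def)
  qed (use H_ev B'_ev in auto)
  ultimately show ?thesis
    using pos by (simp add: field_simps)
qed

lemma increment_tail:
  fixes w :: "code \<Rightarrow> real"
  assumes "0 < p" "0 \<le> \<epsilon>" "0 < s" and w: "\<And>c. 0 \<le> w c" "\<And>c. w c \<le> s"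
  shows "prob {\<omega> \<in> space M. \<epsilon> * p * max (p ^ n) (\<Sum>c\<in>children k (S n \<omega>). w c)
      < \<bar>(\<Sum>c\<in>S (Suc n) \<omega>. w c) - p * (\<Sum>c\<in>children k (S n \<omega>). w c)\<bar>}
    \<le> 2 * exp (- 2 * \<epsilon>\<^sup>2 * p ^ (n + 2) / s)" (is "prob ?B \<le> _")
proof (rule prob_le_of_fibres)
  \<comment> \<open>Restriction to \<open>{..n}\<close> makes the history a point of a finite
    product, so it has only finitely many values.\<close>
  let ?f = "\<lambda>\<omega>. restrict (\<lambda>m. S m \<omega>) {..n}"
  have eq: "{\<omega> \<in> space M. ?f \<omega> = ?f \<omega>0} = {\<omega> \<in> space M. \<forall>m\<le>n. S m \<omega> = S m \<omega>0}" for \<omega>0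
    by (auto simp: restrict_def fun_eq_iff; metis)
  have "?f ` space M \<subseteq> PiE {..n} (\<lambda>m. Pow (codes k m))"
    by (intro image_subsetI) (use retained_subset_codes in \<open>simp add: PiE_iff\<close>)
  then show "finite (?f ` space M)"
    by (rule finite_subset) (auto intro!: finite_PiE)
  show "?B \<in> events"
    by (rule retained_pair_event)
  fix h
  show "{\<omega> \<in> space M. ?f \<omega> = h} \<in> events"
  proof (cases "\<exists>\<omega>0\<in>space M. ?f \<omega>0 = h")
    case True
    then obtain \<omega>0 where "h = ?f \<omega>0" by blast
    then show ?thesis
      unfolding eq by (simp only: eq) (rule history_event)
  next
    case False
    then have "{\<omega> \<in> space M. ?f \<omega> = h} = {}" by blast
    then show ?thesis by (metis sets.empty_sets)
  qed
  assume pos: "prob {\<omega> \<in> space M. ?f \<omega> = h} > 0"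
  then have "{\<omega> \<in> space M. ?f \<omega> = h} \<noteq> {}"
    by (metis less_irrefl measure_empty)
  then obtain \<omega>0 where \<omega>0: "\<omega>0 \<in> space M" "h = ?f \<omega>0" by blast
  show "prob (?B \<inter> {\<omega> \<in> space M. ?f \<omega> = h})
      \<le> 2 * exp (- 2 * \<epsilon>\<^sup>2 * p ^ (n + 2) / s) * prob {\<omega> \<in> space M. ?f \<omega> = h}"
    using pos unfolding \<omega>0(2) eq
    by (intro increment_tail_given_history[OF assms \<omega>0(1) refl _ refl])
qed

end

text \<open>Since \<open>exp x\<close> dominates \<open>x ^ m / fact m\<close>, the exponential
  beats any power of \<open>q ^ n\<close>. With \<open>m\<close> so large that
  \<open>q ^ m > 2 * D\<close>, the terms are bounded by a multiple of
  \<open>(1 / 2) ^ n\<close>.\<close>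

lemma summable_power_mult_exp_neg_power:
  fixes D a q :: real
  assumes "0 < a" "1 < q" "0 \<le> D"
  shows "summable (\<lambda>n. D ^ n * exp (- a * q ^ n))"
proof -
  obtain m where m: "2 * D < q ^ m"
    using real_arch_pow[OF \<open>1 < q\<close>] by blast
  have exp: "x ^ m / fact m \<le> exp x" if "0 \<le> x" for x :: real
  proof -
    have "x ^ m / fact m = (\<Sum>i\<in>{m}. x ^ i /\<^sub>R fact i)"
      by (simp add: divide_real_def)
    also have "\<dots> \<le> (\<Sum>i. x ^ i /\<^sub>R fact i)"
      using that by (intro sum_le_suminf summable_exp_generic) auto
    finally show ?thesis by (simp add: exp_def)
  qed
  show ?thesis
  proof (rule summable_comparison_test')
    show "summable (\<lambda>n. fact m / a ^ m * (1 / 2) ^ n :: real)"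
      by (intro summable_mult summable_geometric) simp
  next
    fix n :: nat assume "0 \<le> n"
    have "exp (- a * q ^ n) \<le> fact m / (a * q ^ n) ^ m"
      using exp[of "a * q ^ n"] assms by (simp add: exp_minus field_simps)
    then have "D ^ n * exp (- a * q ^ n) \<le> D ^ n * (fact m / (a * q ^ n) ^ m)"
      using assms by (intro mult_left_mono) auto
    also have "\<dots> = fact m / a ^ m * (D / q ^ m) ^ n"
      by (simp add: power_mult_distrib power_divide flip: power_mult) (simp add: mult.commute)
    also have "\<dots> \<le> fact m / a ^ m * (1 / 2) ^ n"
      using m assms by (intro mult_left_mono power_mono) (auto simp: field_simps)
    finally show "norm (D ^ n * exp (- a * q ^ n)) \<le> fact m / a ^ m * (1 / 2) ^ n"
      using assms by simp
  qed
qed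

text \<open>A union bound over \<open>J n\<close> followed by Borel-Cantelli. The weights are
  deterministic, so a whole family of lines can be tested at each generation, as long as its size
  grows at most exponentially.\<close>

lemma (in fractal_percolation) AE_increments_le:
  fixes w :: "nat \<Rightarrow> 'j \<Rightarrow> code \<Rightarrow> real"
  assumes "0 < p" "0 < k" "0 < r" and q: "1 < r\<^sup>2 * (k * p)"
    and J: "\<And>n. finite (J n)" "\<And>n. real (card (J n)) \<le> C * D ^ n" "0 \<le> D"
    and w: "\<And>n j c. 0 \<le> w n j c" "\<And>n j c. w n j c \<le> 1 / real k ^ Suc n"
  shows "AE \<omega> in M. \<exists>n0. \<forall>n\<ge>n0. \<forall>j\<in>J n.
    \<bar>(\<Sum>c\<in>S (Suc n) \<omega>. w n j c) - p * (\<Sum>c\<in>children k (S n \<omega>). w n j c)\<bar>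
      \<le> r ^ n * p * max (p ^ n) (\<Sum>c\<in>children k (S n \<omega>). w n j c)"
proof -
  define B where "B n j = {\<omega> \<in> space M. r ^ n * p * max (p ^ n) (\<Sum>c\<in>children k (S n \<omega>). w n j c)
      < \<bar>(\<Sum>c\<in>S (Suc n) \<omega>. w n j c) - p * (\<Sum>c\<in>children k (S n \<omega>). w n j c)\<bar>}" for n j
  \<comment> \<open>With \<open>\<epsilon> = r ^ n\<close> and \<open>s = 1 / k ^ Suc n\<close>, the
    exponent of the tail bound is \<open>a\<close> times
    \<open>(r\<^sup>2 * (k * p)) ^ n\<close>.\<close>
  define a where "a = 2 * (p\<^sup>2 * k)"
  have B_ev: "B n j \<in> events" for n j
    unfolding B_def by (rule retained_pair_event)
  have B_prob: "prob (B n j) \<le> 2 * exp (- a * (r\<^sup>2 * (k * p)) ^ n)" for n j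
  proof -
    have "prob (B n j) \<le> 2 * exp (- 2 * (r ^ n)\<^sup>2 * p ^ (n + 2) / (1 / real k ^ Suc n))"
      unfolding B_def using assms by (intro increment_tail w) auto
    also have "- 2 * (r ^ n)\<^sup>2 * p ^ (n + 2) / (1 / real k ^ Suc n) = - a * (r\<^sup>2 * (k * p)) ^ n"
      by (simp add: a_def power_mult_distrib power2_eq_square mult_ac)
    finally show ?thesis .
  qed
  have U_prob: "prob (\<Union>j\<in>J n. B n j) \<le> 2 * C * (D ^ n * exp (- a * (r\<^sup>2 * (k * p)) ^ n))" for n
  proof -
    have "prob (\<Union>j\<in>J n. B n j) \<le> (\<Sum>j\<in>J n. prob (B n j))"
      using B_ev J by (intro finite_measure_subadditive_finite) auto
    also have "\<dots> \<le> card (J n) * (2 * exp (- a * (r\<^sup>2 * (k * p)) ^ n))"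
      using sum_bounded_above[of "J n" "\<lambda>j. prob (B n j)"] B_prob by auto
    also have "\<dots> \<le> C * D ^ n * (2 * exp (- a * (r\<^sup>2 * (k * p)) ^ n))"
      using J by (intro mult_right_mono) auto
    finally show ?thesis by (simp add: mult_ac)
  qed
  have "0 < a"
    using assms by (simp add: a_def)
  then have "summable (\<lambda>n. 2 * C * (D ^ n * exp (- a * (r\<^sup>2 * (k * p)) ^ n)))"
    using q \<open>0 \<le> D\<close> by (intro summable_mult summable_power_mult_exp_neg_power)
  then have "summable (\<lambda>n. prob (\<Union>j\<in>J n. B n j))"
    by (rule summable_comparison_test'[where N = 0])
      (simp only: real_norm_def abs_of_nonneg[OF measure_nonneg] U_prob)
  then have "AE \<omega> in M. eventually (\<lambda>n. \<omega> \<in> space M - (\<Union>j\<in>J n. B n j)) sequentially"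
    using B_ev J by (intro borel_cantelli_AE1) (auto simp: less_top[symmetric])
  then show ?thesis
    by eventually_elim (auto simp: eventually_sequentially B_def not_less)
qed

section \<open>Half-open cells and traces of lines\<close>

text \<open>The integer with base \<open>k\<close> digits \<open>w\<close>, most significant digit
  first. It turns membership in a cell into an equation between floors.\<close>

definition word_index :: "nat \<Rightarrow> nat list \<Rightarrow> nat" where
  "word_index k w = foldl (\<lambda>a i. a * k + i) 0 w"

lemma word_index_Nil [simp]: "word_index k [] = 0"
  by (simp add: word_index_def)

lemma word_index_snoc [simp]: "word_index k (w @ [i]) = word_index k w * k + i"
  by (simp add: word_index_def)

lemma word_index_less: "set w \<subseteq> {..<k} \<Longrightarrow> word_index k w < k ^ length w"
proof (induction w rule: rev_induct)
  case (snoc i w)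
  then have "Suc (word_index k w) * k \<le> k ^ length w * k" "i < k"
    by (auto intro!: mult_le_mono1 simp del: mult_Suc)
  then show ?case by (simp add: mult.commute)
qed simp

lemma word_index_inj:
  assumes "length u = length v" "set u \<subseteq> {..<k}" "set v \<subseteq> {..<k}" "word_index k u = word_index k v"
  shows "u = v"
  using assms
proof (induction u arbitrary: v rule: rev_induct)
  case (snoc i u)
  then obtain j v' where v: "v = v' @ [j]"
    by (metis length_0_conv rev_exhaust snoc_eq_iff_butlast)
  have "i < k" "j < k" and eq: "word_index k u * k + i = word_index k v' * k + j"
    using snoc.prems v by auto
  from \<open>i < k\<close> \<open>j < k\<close> have "i = j" "word_index k u = word_index k v'"
    using arg_cong[OF eq, of "\<lambda>x. x mod k"] arg_cong[OF eq, of "\<lambda>x. x div k"] by auto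
  then show ?case
    using snoc v by auto
qed simp

lemma left_end_eq: "0 < k \<Longrightarrow> left_end k w = word_index k w / k ^ length w"
proof (induction w rule: rev_induct)
  case (snoc i w)
  have "left_end k (w @ [i]) = left_end k w + i / k ^ Suc (length w)"
    by (simp add: left_end_def nth_append)
  then show ?case
    using snoc by (simp add: field_simps)
qed (simp add: left_end_def)

text \<open>
  Half-open cells tile the plane exactly, so that the projected densities form an exact martingale.
\<close>

definition half_open_interval :: "nat \<Rightarrow> nat list \<Rightarrow> real set" where
  "half_open_interval k w = {x. \<lfloor>x * real k ^ length w\<rfloor> = int (word_index k w)}"

definition half_open_cell :: "nat \<Rightarrow> code \<Rightarrow> (real \<times> real) set" where
  "half_open_cell k c = half_open_interval k (fst c) \<times> half_open_interval k (snd c)"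

lemma half_open_interval_eq:
  assumes "0 < k"
  shows "half_open_interval k w = {left_end k w ..< left_end k w + 1 / real k ^ length w}"
  using assms by (auto simp: half_open_interval_def left_end_eq floor_eq_iff field_simps)

lemma floor_mult_power_Suc_div:
  fixes x :: real
  assumes "0 < k"
  shows "\<lfloor>x * real k ^ Suc n\<rfloor> div int k = \<lfloor>x * real k ^ n\<rfloor>"
proof -
  have "\<lfloor>x * real k ^ Suc n / of_int (int k)\<rfloor> = \<lfloor>x * real k ^ Suc n\<rfloor> div int k"
    by (rule floor_divide_real_eq_div) simp
  then show ?thesis
    using assms by simp
qed

text \<open>Division with remainder: the quotient of the finer floor by \<open>k\<close> is the
  floor one generation earlier and fixes the parent, the remainder is the new digit. Both the tiling
  by children and the disjointness of siblings come from this.\<close>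

lemma half_open_interval_snoc:
  assumes "i < k"
  shows "x \<in> half_open_interval k (w @ [i]) \<longleftrightarrow>
    x \<in> half_open_interval k w \<and> \<lfloor>x * real k ^ Suc (length w)\<rfloor> mod int k = int i"
proof -
  let ?N = "\<lfloor>x * real k ^ Suc (length w)\<rfloor>" and ?m = "word_index k w"
  have "0 < k" using assms by simp
  have "(?m * k + i) div k = ?m" "(?m * k + i) mod k = i"
    using assms by auto
  then have "int (?m * k + i) div int k = int ?m" "int (?m * k + i) mod int k = int i"
    by (simp_all only: flip: zdiv_int zmod_int)
  then have "?N = int (?m * k + i) \<longleftrightarrow> ?N div int k = int ?m \<and> ?N mod int k = int i"
    by (metis div_mult_mod_eq)
  then show ?thesis
    by (simp add: half_open_interval_def floor_mult_power_Suc_div[OF \<open>0 < k\<close>] del: power_Suc)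
qed

lemma half_open_interval_split:
  assumes "0 < k"
  shows "half_open_interval k w = (\<Union>i<k. half_open_interval k (w @ [i]))"
proof safe
  fix x assume x: "x \<in> half_open_interval k w"
  let ?i = "nat (\<lfloor>x * real k ^ Suc (length w)\<rfloor> mod int k)"
  have "?i < k"
    using assms by (simp add: nat_less_iff)
  with x assms show "x \<in> (\<Union>i<k. half_open_interval k (w @ [i]))"
    by (intro UN_I[of ?i]) (simp_all add: half_open_interval_snoc)
qed (simp add: half_open_interval_snoc)

lemma half_open_cell_split:
  assumes "0 < k"
  shows "half_open_cell k (u, v) = (\<Union>(i, j)\<in>{..<k} \<times> {..<k}. half_open_cell k (u @ [i], v @ [j]))"
  unfolding half_open_cell_def fst_conv snd_conv half_open_interval_split[OF assms, of u]
    half_open_interval_split[OF assms, of v] by auto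

lemma half_open_cell_siblings_disjoint:
  "disjoint_family_on (\<lambda>(i, j). half_open_cell k (u @ [i], v @ [j])) ({..<k} \<times> {..<k})"
  by (auto simp: disjoint_family_on_def half_open_cell_def half_open_interval_snoc)

lemma half_open_cell_disjoint:
  "disjoint_family_on (half_open_cell k) (codes k n)"
  unfolding disjoint_family_on_def
proof (intro ballI impI)
  fix c d assume *: "c \<in> codes k n" "d \<in> codes k n" "c \<noteq> d"
  show "half_open_cell k c \<inter> half_open_cell k d = {}"
  proof (rule ccontr)
    assume "half_open_cell k c \<inter> half_open_cell k d \<noteq> {}"
    then have "word_index k (fst c) = word_index k (fst d)" "word_index k (snd c) = word_index k (snd d)"
      using * by (auto simp: half_open_cell_def half_open_interval_def codes_def)
    then have "c = d"
      using * by (auto simp: codes_def intro: word_index_inj)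
    with * show False by simp
  qed
qed

lemma half_open_interval_borel [measurable]: "half_open_interval k w \<in> sets borel"
  unfolding half_open_interval_def by measurable

lemma half_open_cell_borel [measurable]: "half_open_cell k c \<in> sets borel"
  unfolding half_open_cell_def by (intro borel_Times) auto

lemma half_open_interval_subset_unit:
  assumes "set w \<subseteq> {..<k}" "x \<in> half_open_interval k w"
  shows "0 \<le> x" "x < 1"
proof -
  have k: "0 < k ^ length w"
    using word_index_less[OF assms(1)] by (rule le_less_trans[OF le0])
  have "real (word_index k w) \<le> x * real k ^ length w" "x * real k ^ length w < real (word_index k w) + 1"
    using assms(2) by (auto simp: half_open_interval_def floor_eq_iff)
  moreover have "real (word_index k w) + 1 \<le> real (k ^ length w)"
    using word_index_less[OF assms(1)] by linarith
  ultimately have "0 \<le> x * real k ^ length w" "x * real k ^ length w < 1 * real k ^ length w"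
    by auto
  moreover have "0 < real k ^ length w"
    using k by (metis of_nat_0_less_iff of_nat_power)
  ultimately show "0 \<le> x" "x < 1"
    by (auto simp: zero_le_mult_iff mult_less_cancel_right)
qed

lemma emeasure_half_open_interval:
  assumes "0 < k"
  shows "emeasure lborel (half_open_interval k w) = ennreal (1 / real k ^ length w)"
  using assms by (simp add: half_open_interval_eq)

text \<open>The parameter of the line is one of its two coordinates. Length is thus measured in that
  coordinate instead of along the line, and a cell of generation \<open>n\<close> has a trace of
  length at most \<open>k ^ - n\<close> in every direction.\<close>

definition graph_like :: "(real \<Rightarrow> real \<times> real) \<Rightarrow> bool" where
  "graph_like L \<longleftrightarrow> L \<in> borel_measurable borel \<and> ((\<forall>x. fst (L x) = x) \<or> (\<forall>x. snd (L x) = x))"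

definition trace_length :: "nat \<Rightarrow> (real \<Rightarrow> real \<times> real) \<Rightarrow> code \<Rightarrow> real" where
  "trace_length k L c = measure lborel (L -` half_open_cell k c)"

lemma graph_like_vimage [measurable]:
  assumes "graph_like L" "A \<in> sets borel"
  shows "L -` A \<in> sets borel"
  using assms measurable_sets[of L borel borel A] by (simp add: graph_like_def)

lemma emeasure_trace_le:
  assumes "0 < k" "graph_like L" "(u, v) \<in> codes k n"
  shows "emeasure lborel (L -` half_open_cell k (u, v)) \<le> ennreal (1 / real k ^ n)"
proof -
  from assms(2) consider "\<forall>x. fst (L x) = x" | "\<forall>x. snd (L x) = x"
    by (auto simp: graph_like_def)
  then obtain w where w: "w \<in> {u, v}" "L -` half_open_cell k (u, v) \<subseteq> half_open_interval k w"
  proof cases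
    case 1
    then have "L -` half_open_cell k (u, v) \<subseteq> half_open_interval k u"
      unfolding half_open_cell_def by (metis (no_types) fst_conv mem_Times_iff subsetI vimageE)
    then show ?thesis using that by blast
  next
    case 2
    then have "L -` half_open_cell k (u, v) \<subseteq> half_open_interval k v"
      unfolding half_open_cell_def by (metis (no_types) snd_conv mem_Times_iff subsetI vimageE)
    then show ?thesis using that by blast
  qed
  have "emeasure lborel (L -` half_open_cell k (u, v)) \<le> emeasure lborel (half_open_interval k w)"
    using w by (intro emeasure_mono) auto
  also have "\<dots> = ennreal (1 / real k ^ n)"
    using w assms by (auto simp: emeasure_half_open_interval codes_def)
  finally show ?thesis .
qed

lemma trace_length_bounds:
  assumes "0 < k" "graph_like L" "c \<in> codes k n"
  shows "emeasure lborel (L -` half_open_cell k c) = ennreal (trace_length k L c)"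
    "0 \<le> trace_length k L c" "trace_length k L c \<le> 1 / real k ^ n"
proof -
  have le: "emeasure lborel (L -` half_open_cell k c) \<le> ennreal (1 / real k ^ n)"
    using emeasure_trace_le assms by (cases c) auto
  then show eq: "emeasure lborel (L -` half_open_cell k c) = ennreal (trace_length k L c)"
    unfolding trace_length_def by (intro emeasure_eq_ennreal_measure) (auto simp: top_unique)
  show "0 \<le> trace_length k L c"
    by (simp add: trace_length_def)
  show "trace_length k L c \<le> 1 / real k ^ n"
    using le unfolding eq by (subst (asm) ennreal_le_iff) auto
qed

lemma sum_children:
  assumes "finite A"
  shows "(\<Sum>c\<in>children k A. f c) = (\<Sum>(u, v)\<in>A. \<Sum>(i, j)\<in>{..<k} \<times> {..<k}. f (u @ [i], v @ [j]))"
proof -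
  let ?g = "\<lambda>((u, v), i, j). (u @ [i], v @ [j])"
  have "children k A = ?g ` (A \<times> {..<k} \<times> {..<k})"
    by (force simp: children_def image_iff)
  moreover have "inj_on ?g (A \<times> {..<k} \<times> {..<k})"
    by (auto simp: inj_on_def)
  ultimately have "(\<Sum>c\<in>children k A. f c) = (\<Sum>x\<in>A \<times> {..<k} \<times> {..<k}. f (?g x))"
    by (simp add: sum.reindex)
  then show ?thesis
    using assms by (simp add: sum.cartesian_product case_prod_beta)
qed

text \<open>The \<open>k ^ 2\<close> potential children tile their parent exactly, so the trace on
  the parent splits additively. This makes \<open>p\<close> times the current trace the conditional
  mean of the next one.\<close>

lemma sum_children_trace_length:
  assumes "0 < k" and L: "graph_like L" and "A \<subseteq> codes k n"
  shows "(\<Sum>c\<in>children k A. trace_length k L c) = (\<Sum>c\<in>A. trace_length k L c)"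
proof -
  have "(\<Sum>(i, j)\<in>{..<k} \<times> {..<k}. trace_length k L (u @ [i], v @ [j])) = trace_length k L (u, v)"
    if "(u, v) \<in> A" for u v
  proof -
    let ?T = "\<lambda>(i, j). L -` half_open_cell k (u @ [i], v @ [j])"
    have "(u @ [i], v @ [j]) \<in> codes k (Suc n)" if "i < k" "j < k" for i j
      using that \<open>(u, v) \<in> A\<close> assms by (auto simp: codes_def)
    then have fin: "emeasure lborel (L -` half_open_cell k (u @ [i], v @ [j])) \<noteq> \<infinity>" if "i < k" "j < k" for i j
      using that emeasure_trace_le[OF \<open>0 < k\<close> L, of "u @ [i]" "v @ [j]" "Suc n"] by (auto simp: top_unique)
    have "measure lborel (\<Union>x\<in>{..<k} \<times> {..<k}. ?T x) = (\<Sum>x\<in>{..<k} \<times> {..<k}. measure lborel (?T x))"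
    proof (rule measure_finite_Union)
      show "disjoint_family_on ?T ({..<k} \<times> {..<k})"
        using half_open_cell_siblings_disjoint[of k u v] by (fastforce simp: disjoint_family_on_def)
    qed (use fin L in auto)
    moreover have "(\<Union>x\<in>{..<k} \<times> {..<k}. ?T x) = L -` half_open_cell k (u, v)"
      by (subst half_open_cell_split[OF \<open>0 < k\<close>, of u v]) auto
    ultimately show ?thesis
      by (simp add: trace_length_def case_prod_beta)
  qed
  then have "(\<Sum>(u, v)\<in>A. \<Sum>(i, j)\<in>{..<k} \<times> {..<k}. trace_length k L (u @ [i], v @ [j]))
      = (\<Sum>c\<in>A. trace_length k L c)"
    by (intro sum.cong) auto
  then show ?thesis
    using assms(3) by (simp add: sum_children finite_subset[OF _ finite_codes])
qed

section \<open>Geometric rates and Hoelder continuity\<close>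

text \<open>The error at \<open>n\<close> is the tail of the telescoping series, which a geometric
  series dominates.\<close>

lemma geometric_increments_limit:
  fixes x :: "nat \<Rightarrow> real"
  assumes r: "0 \<le> r" "r < 1" and x: "\<And>n. \<bar>x (Suc n) - x n\<bar> \<le> B * r ^ n"
  shows "\<exists>l. \<forall>n. \<bar>x n - l\<bar> \<le> B / (1 - r) * r ^ n"
proof -
  have geo: "summable (\<lambda>i. B * r ^ n * r ^ i)" "(\<Sum>i. B * r ^ n * r ^ i) = B / (1 - r) * r ^ n" for n
    using r by (auto simp: suminf_mult suminf_geometric)
  have le: "\<bar>x (Suc (i + n)) - x (i + n)\<bar> \<le> B * r ^ n * r ^ i" for i n
    using x[of "i + n"] by (simp add: power_add mult_ac)
  have sa: "summable (\<lambda>i. \<bar>x (Suc (i + n)) - x (i + n)\<bar>)" for n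
    using le by (intro summable_comparison_test'[OF geo(1)[of n], of 0]) auto
  have s: "summable (\<lambda>i. x (Suc (i + n)) - x (i + n))" for n
    by (rule summable_rabs_cancel[OF sa])
  have "convergent x"
  proof -
    have "summable (\<lambda>i. x (Suc i) - x i)"
      using s[of 0] by simp
    then have "convergent (\<lambda>n. \<Sum>i<n. x (Suc i) - x i)"
      by (simp add: summable_iff_convergent)
    then have "convergent (\<lambda>n. x n - x 0)"
      by (simp add: sum_lessThan_telescope)
    then show ?thesis
      by (simp add: convergent_diff_const_right_iff)
  qed
  then obtain l where l: "x \<longlonglongrightarrow> l"
    by (auto simp: convergent_def)
  have "\<bar>x n - l\<bar> \<le> B / (1 - r) * r ^ n" for n
  proof -
    have "(\<lambda>i. x (i + n)) \<longlonglongrightarrow> l"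
      using l by (rule LIMSEQ_ignore_initial_segment)
    then have "(\<lambda>i. x (Suc (i + n)) - x (i + n)) sums (l - x n)"
      using telescope_sums[of "\<lambda>i. x (i + n)" l] by simp
    then have "\<bar>x n - l\<bar> = \<bar>\<Sum>i. x (Suc (i + n)) - x (i + n)\<bar>"
      by (simp add: sums_iff abs_minus_commute)
    also have "\<dots> \<le> (\<Sum>i. \<bar>x (Suc (i + n)) - x (i + n)\<bar>)"
      by (rule summable_rabs[OF sa])
    also have "\<dots> \<le> (\<Sum>i. B * r ^ n * r ^ i)"
      by (intro suminf_le le sa geo)
    finally show ?thesis
      by (simp add: geo)
  qed
  then show ?thesis by blast
qed

text \<open>Boundedness comes first: adding \<open>2\<close> makes the recursion multiplicative,
  \<open>X + 2\<close> grows at most by the factor \<open>1 + r ^ n \<le> exp (r ^ n)\<close>, and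
  the sum of the exponents is at most \<open>1 / (1 - r)\<close>. Then the increments are bounded by
  a multiple of \<open>r ^ n\<close>, with constants independent of \<open>t\<close>.\<close>

lemma relative_increments_uniform_limit:
  fixes X :: "nat \<Rightarrow> 't \<Rightarrow> real"
  assumes r: "0 < r" "r < 1" and nonneg: "\<And>n t. 0 \<le> X n t" and b: "\<And>n t. X n t \<le> b n"
    and X: "\<And>n t. n0 \<le> n \<Longrightarrow> \<bar>X (Suc n) t - X n t\<bar> \<le> r ^ n * (X n t + 2)"
  shows "\<exists>C f. \<forall>n t. \<bar>X n t - f t\<bar> \<le> C * r ^ n"
proof -
  define B where "B = (b n0 + 2) * exp (1 / (1 - r))"
  have "0 \<le> b n" for n
    using nonneg b order_trans by blast
  have bound: "X (n0 + i) t + 2 \<le> (b n0 + 2) * exp (\<Sum>j<i. r ^ (n0 + j))" for i t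
  proof (induction i)
    case 0
    then show ?case using b[of n0 t] by simp
  next
    case (Suc i)
    have "X (n0 + Suc i) t + 2 \<le> (X (n0 + i) t + 2) * (1 + r ^ (n0 + i))"
      using X[of "n0 + i" t] by (simp add: algebra_simps)
    also have "\<dots> \<le> (X (n0 + i) t + 2) * exp (r ^ (n0 + i))"
      using nonneg[of "n0 + i" t] exp_ge_add_one_self by (intro mult_left_mono) auto
    also have "\<dots> \<le> (b n0 + 2) * exp (\<Sum>j<i. r ^ (n0 + j)) * exp (r ^ (n0 + i))"
      by (intro mult_right_mono Suc.IH) simp
    finally show ?case by (simp add: exp_add mult_ac)
  qed
  have "(\<Sum>j<i. r ^ (n0 + j)) \<le> 1 / (1 - r)" for i
  proof -
    have "(\<Sum>j<i. r ^ (n0 + j)) \<le> (\<Sum>j<i. r ^ j)"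
      using r by (intro sum_mono power_decreasing) auto
    also have "\<dots> \<le> (\<Sum>j. r ^ j)"
      using r by (intro sum_le_suminf summable_geometric) auto
    finally show ?thesis using r by (simp add: suminf_geometric)
  qed
  then have B: "X (n0 + i) t + 2 \<le> B" for i t
    unfolding B_def using \<open>0 \<le> b n0\<close>
    by (intro order_trans[OF bound] mult_left_mono) auto
  \<comment> \<open>The finitely many increments before \<open>n0\<close> obey no rate; the added
    sum absorbs them.\<close>
  define B' where "B' = B + (\<Sum>m<n0. (b m + b (Suc m)) / r ^ m)"
  have "0 \<le> B"
    unfolding B_def using \<open>0 \<le> b n0\<close> by simp
  have "\<bar>X (Suc n) t - X n t\<bar> \<le> B' * r ^ n" for n t
  proof (cases "n0 \<le> n")
    case True
    then have "\<bar>X (Suc n) t - X n t\<bar> \<le> r ^ n * B"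
      using B[of "n - n0" t] r by (intro order_trans[OF X] mult_left_mono) auto
    also have "\<dots> \<le> r ^ n * B'"
      using r \<open>\<And>n. 0 \<le> b n\<close> by (auto simp: B'_def intro!: sum_nonneg divide_nonneg_pos)
    finally show ?thesis by (simp add: mult.commute)
  next
    case False
    have "\<bar>X (Suc n) t - X n t\<bar> \<le> b n + b (Suc n)"
      using nonneg[of n t] nonneg[of "Suc n" t] b[of n t] b[of "Suc n" t] by linarith
    also have "\<dots> = (b n + b (Suc n)) / r ^ n * r ^ n"
      using r by simp
    also have "(b n + b (Suc n)) / r ^ n \<le> (\<Sum>m<n0. (b m + b (Suc m)) / r ^ m)"
      using False r \<open>\<And>n. 0 \<le> b n\<close> by (intro member_le_sum) (auto intro!: divide_nonneg_pos)
    also have "\<dots> \<le> B'"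
      using \<open>0 \<le> B\<close> by (simp add: B'_def)
    finally show ?thesis
      using r by (simp add: mult_right_mono)
  qed
  then have "\<exists>l. \<forall>n. \<bar>X n t - l\<bar> \<le> B' / (1 - r) * r ^ n" for t
    using r by (intro geometric_increments_limit[of r "\<lambda>n. X n t"]) auto
  then show ?thesis by metis
qed

text \<open>
  The index \<open>n\<close> at which \<open>f\<close> is replaced by \<open>X n\<close> balances the Lipschitz constant against the
  rate: it is the largest one with \<open>(A / r) ^ n * \<bar>x - y\<bar> \<le> 1\<close>.
\<close>

lemma holder_of_geometric_approximation:
  fixes X :: "nat \<Rightarrow> real \<Rightarrow> real"
  assumes r: "0 < r" "r < 1" and "1 \<le> A" and rate: "\<And>n t. \<bar>X n t - f t\<bar> \<le> C * r ^ n"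
    and lip: "\<And>n s t. \<bar>X n s - X n t\<bar> \<le> K * A ^ n * \<bar>s - t\<bar>" and b: "\<And>t. \<bar>X 0 t\<bar> \<le> b"
  shows "holder_on dist UNIV f"
proof -
  define q where "q = A / r"
  \<comment> \<open>Chosen so that \<open>q powr \<alpha> = 1 / r\<close>: a distance of order
    \<open>q ^ - n\<close> then becomes an error of order \<open>r ^ n\<close>. Because
    \<open>1 \<le> A\<close>, the exponent is at most \<open>1\<close>.\<close>
  define \<alpha> where "\<alpha> = ln (1 / r) / ln q"
  have q: "1 < q" "1 / r \<le> q"
    using r \<open>1 \<le> A\<close> by (auto simp: q_def divide_simps)
  have "0 < ln (1 / r)"
    using r by (intro ln_gt_zero) (simp add: field_simps)
  moreover have "ln (1 / r) \<le> ln q"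
    using q r by (subst ln_le_cancel_iff) (auto intro: less_trans[OF zero_less_one])
  ultimately have \<alpha>: "0 < \<alpha>" "\<alpha> \<le> 1"
    by (auto simp: \<alpha>_def)
  have q_powr: "q powr \<alpha> = 1 / r"
    using q r \<open>0 < ln (1 / r)\<close> by (simp add: powr_def \<alpha>_def)
  have "0 \<le> C"
    using rate[of 0 0] by simp
  have "0 \<le> K"
    using lip[of 0 0 1] by simp
  have "0 \<le> b"
    using b[of 0] by linarith
  \<comment> \<open>The first summand serves points at distance at most \<open>1\<close>, its
    division by \<open>r\<close> paying for the passage from \<open>n\<close> to
    \<open>Suc n\<close>. The second serves distant points, where it suffices that \<open>f\<close>
    is bounded by \<open>b + C\<close>.\<close>
  define D where "D = (2 * C + K) / r + 2 * (b + C)"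
  have "\<bar>f x - f y\<bar> \<le> D * dist x y powr \<alpha>" for x y
  proof (cases "x = y")
    case False
    then have d: "0 < dist x y" by simp
    show ?thesis
    proof (cases "dist x y \<le> 1")
      case True
      have "\<exists>n. 1 < q ^ n * dist x y"
      proof -
        obtain n where "1 / dist x y < q ^ n"
          using real_arch_pow[OF q(1)] by blast
        then show ?thesis using d by (auto simp: field_simps)
      qed
      then obtain n where n: "1 < q ^ Suc n * dist x y" "q ^ n * dist x y \<le> 1"
      proof -
        define m where "m = (LEAST n. 1 < q ^ n * dist x y)"
        have m: "1 < q ^ m * dist x y"
          unfolding m_def using \<open>\<exists>n. _\<close> by (rule LeastI_ex)
        then obtain n where "m = Suc n"
          using True by (cases m) auto
        then have "q ^ n * dist x y \<le> 1"
          using not_less_Least[of n "\<lambda>n. 1 < q ^ n * dist x y"] by (auto simp: m_def)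
        with m \<open>m = Suc n\<close> show ?thesis using that by blast
      qed
      have "r ^ Suc n \<le> dist x y powr \<alpha>"
      proof -
        have "r ^ Suc n = ((1 / q ^ Suc n)) powr \<alpha>"
        proof -
          have "(1 / q ^ Suc n) powr \<alpha> = 1 / (q powr \<alpha>) ^ Suc n"
            using q by (simp add: powr_divide powr_powr powr_mult flip: powr_realpow)
              (simp add: powr_add powr_powr powr_mult powr_realpow mult_ac flip: powr_realpow)
          then show ?thesis
            using r by (simp add: q_powr power_divide)
        qed
        also have "\<dots> \<le> dist x y powr \<alpha>"
          using n q \<alpha> by (intro powr_mono2) (auto simp: field_simps)
        finally show ?thesis .
      qed
      moreover have "A ^ n * dist x y \<le> r ^ n"
        using n(2) r by (simp add: q_def power_divide field_simps)
      then have "K * A ^ n * dist x y \<le> K * r ^ n"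
        using \<open>0 \<le> K\<close> by (metis mult.assoc mult_left_mono)
      then have "\<bar>f x - f y\<bar> \<le> (2 * C + K) * r ^ n"
        using rate[of n x] rate[of n y] lip[of n x y] by (simp add: dist_real_def algebra_simps)
      ultimately have "\<bar>f x - f y\<bar> \<le> (2 * C + K) / r * dist x y powr \<alpha>"
      proof -
        assume *: "r ^ Suc n \<le> dist x y powr \<alpha>" "\<bar>f x - f y\<bar> \<le> (2 * C + K) * r ^ n"
        have "(2 * C + K) * r ^ n = (2 * C + K) / r * r ^ Suc n"
          using r by simp
        also have "\<dots> \<le> (2 * C + K) / r * dist x y powr \<alpha>"
          using * r \<open>0 \<le> C\<close> \<open>0 \<le> K\<close> by (intro mult_left_mono) auto
        finally show ?thesis using * by linarith
      qed
      also have "\<dots> \<le> D * dist x y powr \<alpha>"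
        using \<open>0 \<le> b\<close> \<open>0 \<le> C\<close> by (intro mult_right_mono) (auto simp: D_def)
      finally show ?thesis .
    next
      case False
      have "\<bar>f x - f y\<bar> \<le> 2 * (b + C)"
        using rate[of 0 x] rate[of 0 y] b[of x] b[of y] by simp
      also have "\<dots> \<le> D"
        using r \<open>0 \<le> C\<close> \<open>0 \<le> K\<close> by (simp add: D_def)
      also have "\<dots> \<le> D * dist x y powr \<alpha>"
      proof -
        have "0 \<le> D"
          using r \<open>0 \<le> C\<close> \<open>0 \<le> K\<close> \<open>0 \<le> b\<close> by (simp add: D_def)
        moreover have "1 \<le> dist x y powr \<alpha>"
          using False \<alpha> by (intro ge_one_powr_ge_zero) auto
        ultimately show ?thesis
          using mult_left_mono[of 1 "dist x y powr \<alpha>" D] by simp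
      qed
      finally show ?thesis .
    qed
  qed simp
  with \<alpha> show ?thesis
    unfolding holder_on_def by blast
qed

lemma adic_dist_commute: "adic_dist k x y = adic_dist k y x"
  unfolding adic_dist_def min.commute[of x y] max.commute[of x y] by auto

text \<open>If level \<open>l\<close> is the first with a grid point between \<open>x\<close> and
  \<open>y\<close>, both points lie in one interval of level \<open>l - 1\<close>, where
  \<open>X (l - 1)\<close> is constant. The difference of the values of \<open>f\<close> is then at
  most \<open>2 * C * r ^ (l - 1)\<close>, while the distance is \<open>k ^ - l\<close>. The
  condition \<open>1 / k \<le> r\<close> keeps the exponent at most \<open>1\<close>.\<close>

lemma holder_adic_of_geometric_approximation:
  fixes X :: "nat \<Rightarrow> real \<Rightarrow> real"
  assumes r: "0 < r" "r < 1" "1 / k \<le> r" and "2 \<le> k" and rate: "\<And>n t. \<bar>X n t - f t\<bar> \<le> C * r ^ n"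
    and const: "\<And>n s t. \<lfloor>s * real k ^ n\<rfloor> = \<lfloor>t * real k ^ n\<rfloor> \<Longrightarrow> X n s = X n t"
  shows "holder_on (adic_dist k) ({0..1} - adic_points k) f"
proof -
  define \<alpha> where "\<alpha> = ln (1 / r) / ln k"
  have "0 < ln (1 / r)"
    using r by (intro ln_gt_zero) (simp add: field_simps)
  moreover have "ln (1 / r) \<le> ln k"
    using r \<open>2 \<le> k\<close> by (subst ln_le_cancel_iff) (auto simp: field_simps)
  ultimately have \<alpha>: "0 < \<alpha>" "\<alpha> \<le> 1" "\<alpha> * ln k = ln (1 / r)"
    by (auto simp: \<alpha>_def)
  have "0 \<le> C"
    using rate[of 0 0] by simp
  have main: "\<bar>f x - f y\<bar> \<le> 2 * C / r * adic_dist k x y powr \<alpha>"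
    if x: "x \<in> {0..1} - adic_points k" and y: "y \<in> {0..1} - adic_points k" and "x < y" for x y
  proof -
    define P where "P l \<longleftrightarrow> (\<exists>m::int. x < of_int m / real k ^ l \<and> of_int m / real k ^ l < y)" for l
    define l where "l = (LEAST l. P l)"
    have floor_eq: "\<lfloor>x * real k ^ n\<rfloor> = \<lfloor>y * real k ^ n\<rfloor>" if "\<not> P n" for n
    proof (rule ccontr)
      assume "\<lfloor>x * real k ^ n\<rfloor> \<noteq> \<lfloor>y * real k ^ n\<rfloor>"
      moreover have kn: "0 < real k ^ n"
        using \<open>2 \<le> k\<close> by simp
      moreover from this have "\<lfloor>x * real k ^ n\<rfloor> \<le> \<lfloor>y * real k ^ n\<rfloor>"
        using \<open>x < y\<close> by (intro floor_mono) auto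
      ultimately have "x * real k ^ n < of_int \<lfloor>y * real k ^ n\<rfloor>"
        by (simp add: floor_less_iff flip: less_floor_iff) linarith
      then have "x < of_int \<lfloor>y * real k ^ n\<rfloor> / real k ^ n"
        using kn by (simp add: field_simps)
      moreover have "of_int \<lfloor>y * real k ^ n\<rfloor> / real k ^ n \<le> y"
        using kn by (simp add: field_simps)
      \<comment> \<open>Here it matters that \<open>y\<close> is not a \<open>k\<close>-adic point:
        the grid point below \<open>y\<close> lies strictly between \<open>x\<close> and
        \<open>y\<close>.\<close>
      moreover have "of_int \<lfloor>y * real k ^ n\<rfloor> / real k ^ n \<noteq> y"
        using y unfolding adic_points_def by (auto; metis)
      ultimately show False
        using that by (auto simp: P_def)
    qed
    \<comment> \<open>No integer lies strictly between two points of the unit interval. This settles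
      \<open>l = 0\<close>, where \<open>l - 1\<close> is again \<open>0\<close>.\<close>
    have "\<not> P 0"
    proof
      assume "P 0"
      then obtain m :: int where "x < of_int m" "of_int m < y"
        by (auto simp: P_def)
      with x y have "0 < real_of_int m" "real_of_int m < 1"
        by auto
      then show False by simp
    qed
    then have "\<lfloor>x * real k ^ (l - 1)\<rfloor> = \<lfloor>y * real k ^ (l - 1)\<rfloor>"
      using not_less_Least[of "l - 1" P] by (intro floor_eq) (cases "l = 0"; auto simp: l_def)
    then have "X (l - 1) x = X (l - 1) y"
      by (rule const)
    then have "\<bar>f x - f y\<bar> \<le> 2 * C * r ^ (l - 1)"
      using rate[of "l - 1" x] rate[of "l - 1" y] by linarith
    also have "\<dots> \<le> 2 * C / r * r ^ l"
      using r \<open>0 \<le> C\<close> by (cases l) (auto simp: field_simps intro: mult_left_le)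
    also have "r ^ l = adic_dist k x y powr \<alpha>"
    proof -
      have "adic_dist k x y = exp (- ln (real k) * real l)"
        using \<open>x < y\<close> by (simp add: adic_dist_def l_def P_def[abs_def])
      then have "adic_dist k x y powr \<alpha> = exp (- (\<alpha> * ln k) * real l)"
        by (simp add: powr_def mult_ac)
      also have "\<dots> = r ^ l"
        using r unfolding \<alpha> by (simp add: ln_div exp_of_nat2_mult)
      finally show ?thesis by simp
    qed
    finally show ?thesis .
  qed
  have "\<bar>f x - f y\<bar> \<le> 2 * C / r * adic_dist k x y powr \<alpha>"
    if "x \<in> {0..1} - adic_points k" "y \<in> {0..1} - adic_points k" for x y
  proof (cases x y rule: linorder_cases)
    case less
    then show ?thesis using main that by blast
  next
    case equal
    then show ?thesis
      using r \<open>0 \<le> C\<close> by simp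
  next
    case greater
    then have "\<bar>f y - f x\<bar> \<le> 2 * C / r * adic_dist k y x powr \<alpha>"
      using main that by blast
    then show ?thesis
      by (simp only: abs_minus_commute[of "f y"] adic_dist_commute[of k y])
  qed
  with \<alpha> show ?thesis
    unfolding holder_on_def by blast
qed

section \<open>Normalized traces and their limits\<close>

definition trace_sum :: "nat \<Rightarrow> (nat \<Rightarrow> code set) \<Rightarrow> nat \<Rightarrow> (real \<Rightarrow> real \<times> real) \<Rightarrow> real" where
  "trace_sum k s n L = (\<Sum>c\<in>s n. trace_length k L c)"

text \<open>
  With \<open>X n = trace_sum k s n L / p ^ n\<close> the following inequality reads
  \<open>\<bar>X (Suc n) - X n\<bar> \<le> r ^ n * (X n + 2)\<close>.
\<close>

definition regular_trace :: "nat \<Rightarrow> real \<Rightarrow> real \<Rightarrow> (nat \<Rightarrow> code set) \<Rightarrow> nat \<Rightarrow> (real \<Rightarrow> real \<times> real) \<Rightarrow> bool" where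
  "regular_trace k p r s n L \<longleftrightarrow>
    \<bar>trace_sum k s (Suc n) L - p * trace_sum k s n L\<bar> \<le> r ^ n * p * (trace_sum k s n L + 2 * p ^ n)"

lemma trace_sum_nonneg: "0 \<le> trace_sum k s n L"
  by (simp add: trace_sum_def trace_length_def sum_nonneg)

text \<open>All \<open>k ^ (2 * n)\<close> cells are counted with the maximal trace. The crude bound
  suffices, since it serves only as a starting value and for finitely many early
  generations.\<close>

lemma trace_sum_le:
  assumes "0 < k" "graph_like L" "s n \<subseteq> codes k n"
  shows "trace_sum k s n L \<le> real k ^ n"
proof -
  have "trace_sum k s n L \<le> real (card (s n)) * (1 / real k ^ n)"
    unfolding trace_sum_def using assms by (intro sum_bounded_above trace_length_bounds) auto
  also have "card (s n) \<le> (k ^ n)\<^sup>2"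
    using card_mono[OF finite_codes assms(3)] by (simp add: card_codes)
  then have "real (card (s n)) * (1 / real k ^ n) \<le> (real k ^ n)\<^sup>2 * (1 / real k ^ n)"
    by (intro mult_right_mono) (simp_all flip: of_nat_power)
  also have "\<dots> = real k ^ n"
    using assms by (simp add: power2_eq_square)
  finally show ?thesis .
qed

lemma regular_trace_if_null:
  assumes "0 < p" "0 < r" "trace_sum k s (Suc n) L = 0" "trace_sum k s n L = 0"
  shows "regular_trace k p r s n L"
  using assms by (simp add: regular_trace_def)

lemma regular_traces_uniform_limit:
  fixes L :: "real \<Rightarrow> real \<Rightarrow> real \<times> real"
  assumes "0 < p" "0 < k" and r: "0 < r" "r < 1" and L: "\<And>t. graph_like (L t)"
    and s: "\<And>n. s n \<subseteq> codes k n"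
    and reg: "\<And>n t. n0 \<le> n \<Longrightarrow> regular_trace k p r s n (L t)"
  shows "\<exists>C f. \<forall>n t. \<bar>trace_sum k s n (L t) / p ^ n - f t\<bar> \<le> C * r ^ n"
proof (rule relative_increments_uniform_limit[OF r])
  fix n t
  show "0 \<le> trace_sum k s n (L t) / p ^ n"
    using assms by (simp add: trace_sum_nonneg)
  show "trace_sum k s n (L t) / p ^ n \<le> real k ^ n / p ^ n"
    using assms by (intro divide_right_mono trace_sum_le) auto
  assume "n0 \<le> n"
  then have "\<bar>trace_sum k s (Suc n) (L t) - p * trace_sum k s n (L t)\<bar> / p ^ Suc n
      \<le> r ^ n * p * (trace_sum k s n (L t) + 2 * p ^ n) / p ^ Suc n"
    using reg[of n t] \<open>0 < p\<close> unfolding regular_trace_def by (intro divide_right_mono) auto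
  also have "\<dots> = r ^ n * (trace_sum k s n (L t) / p ^ n + 2)"
    using \<open>0 < p\<close> by (simp add: field_simps)
  also have "\<bar>trace_sum k s (Suc n) (L t) - p * trace_sum k s n (L t)\<bar> / p ^ Suc n
      = \<bar>(trace_sum k s (Suc n) (L t) - p * trace_sum k s n (L t)) / p ^ Suc n\<bar>"
    using \<open>0 < p\<close> by (simp add: abs_divide)
  also have "(trace_sum k s (Suc n) (L t) - p * trace_sum k s n (L t)) / p ^ Suc n
      = trace_sum k s (Suc n) (L t) / p ^ Suc n - trace_sum k s n (L t) / p ^ n"
    using \<open>0 < p\<close> by (simp add: diff_divide_distrib)
  finally show "\<bar>trace_sum k s (Suc n) (L t) / p ^ Suc n - trace_sum k s n (L t) / p ^ n\<bar>
      \<le> r ^ n * (trace_sum k s n (L t) / p ^ n + 2)" .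
qed

section \<open>Lines parallel to the axes\<close>

lemma measure_half_open_interval: "0 < k \<Longrightarrow> measure lborel (half_open_interval k w) = 1 / real k ^ length w"
  by (simp add: measure_def emeasure_half_open_interval)

lemma trace_length_horizontal:
  assumes "0 < k" "c \<in> codes k n"
  shows "trace_length k (\<lambda>x. (x, t)) c =
    (if \<lfloor>t * real k ^ n\<rfloor> = int (word_index k (snd c)) then 1 / real k ^ n else 0)"
proof -
  have "(\<lambda>x. (x, t)) -` half_open_cell k c =
      (if \<lfloor>t * real k ^ n\<rfloor> = int (word_index k (snd c)) then half_open_interval k (fst c) else {})"
    using assms by (auto simp: half_open_cell_def half_open_interval_def codes_def)
  then show ?thesis
    using assms by (auto simp: trace_length_def measure_half_open_interval codes_def)
qed

lemma trace_length_vertical: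
  assumes "0 < k" "c \<in> codes k n"
  shows "trace_length k (\<lambda>x. (t, x)) c =
    (if \<lfloor>t * real k ^ n\<rfloor> = int (word_index k (fst c)) then 1 / real k ^ n else 0)"
proof -
  have "(\<lambda>x. (t, x)) -` half_open_cell k c =
      (if \<lfloor>t * real k ^ n\<rfloor> = int (word_index k (fst c)) then half_open_interval k (snd c) else {})"
    using assms by (auto simp: half_open_cell_def half_open_interval_def codes_def)
  then show ?thesis
    using assms by (auto simp: trace_length_def measure_half_open_interval codes_def)
qed

lemma graph_like_horizontal: "graph_like (\<lambda>x. (x, t))"
  by (simp add: graph_like_def borel_prod[symmetric])

lemma graph_like_vertical: "graph_like (\<lambda>x. (t, x))"
  by (simp add: graph_like_def borel_prod[symmetric])

context fractal_percolation
begin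

text \<open>The selector \<open>q\<close> treats both axis directions at once: it names the
  coordinate that is constant along the line.\<close>

lemma AE_regular_trace_axis:
  fixes L :: "real \<Rightarrow> real \<Rightarrow> real \<times> real" and q :: "code \<Rightarrow> nat list"
  assumes "0 < p" "0 < k" "0 < r" "1 < r\<^sup>2 * (k * p)" and q: "q = fst \<or> q = snd"
    and L: "\<And>t. graph_like (L t)"
    and trace: "\<And>n c t. c \<in> codes k n \<Longrightarrow> trace_length k (L t) c =
      (if \<lfloor>t * real k ^ n\<rfloor> = int (word_index k (q c)) then 1 / real k ^ n else 0)"
  shows "AE \<omega> in M. \<exists>n0. \<forall>n\<ge>n0. \<forall>t. regular_trace k p r (\<lambda>n. S n \<omega>) n (L t)"
proof -
  \<comment> \<open>The trace on cells of generation \<open>n + 1\<close> of every line running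
    through the row or column with index \<open>j\<close>.\<close>
  define w where "w n j c = (if word_index k (q c) = j then 1 / real k ^ Suc n else 0)" for n j c
  have "AE \<omega> in M. \<exists>n0. \<forall>n\<ge>n0. \<forall>j\<in>{..<k ^ Suc n}.
    \<bar>(\<Sum>c\<in>S (Suc n) \<omega>. w n j c) - p * (\<Sum>c\<in>children k (S n \<omega>). w n j c)\<bar>
      \<le> r ^ n * p * max (p ^ n) (\<Sum>c\<in>children k (S n \<omega>). w n j c)"
    using assms(1-4)
    by (intro AE_increments_le[where C = "real k" and D = "real k"]) (auto simp: w_def)
  then show ?thesis
    using AE_space
  proof eventually_elim
    case (elim \<omega>)
    then obtain n0 where n0: "\<And>n j. n0 \<le> n \<Longrightarrow> j < k ^ Suc n \<Longrightarrow>
      \<bar>(\<Sum>c\<in>S (Suc n) \<omega>. w n j c) - p * (\<Sum>c\<in>children k (S n \<omega>). w n j c)\<bar>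
        \<le> r ^ n * p * max (p ^ n) (\<Sum>c\<in>children k (S n \<omega>). w n j c)"
      by blast
    let ?s = "\<lambda>n. S n \<omega>"
    have sub: "S n \<omega> \<subseteq> codes k n" for n
      using elim retained_subset_codes by blast
    have "regular_trace k p r ?s n (L t)" if "n0 \<le> n" for n t
    proof -
      have T: "trace_sum k ?s n (L t) = (\<Sum>c\<in>children k (S n \<omega>). trace_length k (L t) c)"
        unfolding trace_sum_def using assms sub by (intro sum_children_trace_length[where n = n, symmetric]) auto
      have w: "trace_length k (L t) c = w n j c" if "c \<in> codes k (Suc n)" "\<lfloor>t * real k ^ Suc n\<rfloor> = int j" for c j
        unfolding trace[OF that(1)] that(2) by (auto simp: w_def)
      show ?thesis
      proof (cases "\<exists>j<k ^ Suc n. \<lfloor>t * real k ^ Suc n\<rfloor> = int j")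
        case True
        then obtain j where j: "j < k ^ Suc n" "\<lfloor>t * real k ^ Suc n\<rfloor> = int j" by blast
        have eq: "(\<Sum>c\<in>A. trace_length k (L t) c) = (\<Sum>c\<in>A. w n j c)" if "A \<subseteq> codes k (Suc n)" for A
          using w j that by (intro sum.cong) auto
        have "\<bar>trace_sum k ?s (Suc n) (L t) - p * trace_sum k ?s n (L t)\<bar>
            \<le> r ^ n * p * max (p ^ n) (trace_sum k ?s n (L t))"
          using n0[OF \<open>n0 \<le> n\<close> j(1)] eq[OF sub] eq[OF children_subset_codes[OF sub]]
          by (simp add: T) (simp add: trace_sum_def)
        also have "\<dots> \<le> r ^ n * p * (trace_sum k ?s n (L t) + 2 * p ^ n)"
          using assms trace_sum_nonneg[of k ?s n "L t"] by (intro mult_left_mono) auto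
        finally show ?thesis by (simp add: regular_trace_def)
      next
        \<comment> \<open>The line misses the unit square.\<close>
        case False
        have "trace_length k (L t) c = 0" if c: "c \<in> codes k (Suc n)" for c
        proof -
          have "word_index k (q c) < k ^ Suc n"
            using c q word_index_less[of "fst c" k] word_index_less[of "snd c" k] by (auto simp: codes_def)
          with False show ?thesis
            unfolding trace[OF c] by auto
        qed
        then have zero: "(\<Sum>c\<in>A. trace_length k (L t) c) = 0" if "A \<subseteq> codes k (Suc n)" for A
          using that by (intro sum.neutral) auto
        have "trace_sum k ?s (Suc n) (L t) = 0"
          unfolding trace_sum_def by (rule zero[OF sub])
        moreover have "trace_sum k ?s n (L t) = 0"
          unfolding T by (rule zero[OF children_subset_codes[OF sub]])
        ultimately show ?thesis
          using assms by (intro regular_trace_if_null)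
      qed
    qed
    then show ?case by blast
  qed
qed

end

section \<open>Slanted lines\<close>

text \<open>
  This is the line \<open>x + \<beta> * y = \<sigma>\<close>. In the parameters \<open>\<beta> = tan \<theta>\<close> and \<open>\<sigma> = t / cos \<theta>\<close> the length of the
  \<open>x\<close>-projection of its trace on a cell has a Lipschitz constant that does not depend on the slope.
\<close>

definition slanted_line :: "real \<Rightarrow> real \<Rightarrow> real \<Rightarrow> real \<times> real" where
  "slanted_line \<beta> \<sigma> x = (x, (\<sigma> - x) / \<beta>)"

text \<open>The overlap of the base of the cell with the range of abscissae
  \<open>\<sigma> - \<beta> * y\<close> for heights \<open>y\<close> in the cell; as a function of
  \<open>\<sigma>\<close> its graph is generally a trapezoid. There is no division by
  \<open>\<beta>\<close>, so the formula extends to \<open>\<beta> = 0\<close>, where grid slopes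
  may fall.\<close>

definition trapezoid :: "nat \<Rightarrow> real \<Rightarrow> real \<Rightarrow> code \<Rightarrow> real" where
  "trapezoid k \<beta> \<sigma> c =
    (let a = left_end k (fst c); b = left_end k (snd c); s = 1 / real k ^ length (fst c) in
     max 0 (min (a + s) (max (\<sigma> - \<beta> * b) (\<sigma> - \<beta> * (b + s))) - max a (min (\<sigma> - \<beta> * b) (\<sigma> - \<beta> * (b + s)))))"

lemma graph_like_slanted: "graph_like (slanted_line \<beta> \<sigma>)"
  by (simp add: graph_like_def slanted_line_def[abs_def] borel_prod[symmetric])

lemma trapezoid_nonneg: "0 \<le> trapezoid k \<beta> \<sigma> c"
  by (simp add: trapezoid_def Let_def)

lemma trapezoid_le: "c \<in> codes k n \<Longrightarrow> trapezoid k \<beta> \<sigma> c \<le> 1 / real k ^ n"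
  by (auto simp: trapezoid_def Let_def codes_def)

lemma left_end_unit:
  assumes "0 < k" "set w \<subseteq> {..<k}"
  shows "0 \<le> left_end k w" "left_end k w + 1 / real k ^ length w \<le> 1"
proof -
  have "real (Suc (word_index k w)) \<le> real (k ^ length w)"
    using word_index_less[OF assms(2)] by (simp only: of_nat_le_iff Suc_le_eq)
  then show "0 \<le> left_end k w" "left_end k w + 1 / real k ^ length w \<le> 1"
    using assms by (auto simp: left_end_eq field_simps)
qed

lemma overlap_lipschitz:
  fixes a e l l' u u' d :: real
  assumes "\<bar>u - u'\<bar> \<le> d" "\<bar>l - l'\<bar> \<le> d"
  shows "\<bar>max 0 (min e u - max a l) - max 0 (min e u' - max a l')\<bar> \<le> 2 * d"
proof -
  have "\<bar>min e u - min e u'\<bar> \<le> d"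
    using assms(1) by (auto simp: min_def abs_le_iff)
  moreover have "\<bar>max a l - max a l'\<bar> \<le> d"
    using assms(2) by (auto simp: max_def abs_le_iff)
  moreover have "\<bar>max 0 x - max 0 y\<bar> \<le> \<bar>x - y\<bar>" for x y :: real
    by (simp add: max_def)
  from this[of "min e u - max a l" "min e u' - max a l'"]
  have "\<bar>max 0 (min e u - max a l) - max 0 (min e u' - max a l')\<bar>
      \<le> \<bar>min e u - min e u'\<bar> + \<bar>max a l - max a l'\<bar>"
    by (rule order_trans) linarith
  ultimately show ?thesis by linarith
qed

text \<open>Cells lie in the unit square, so \<open>0 \<le> y \<le> 1\<close> and the abscissa
  \<open>\<sigma> - \<beta> * y\<close> moves by at most \<open>\<bar>\<sigma> - \<sigma>'\<bar> +
  \<bar>\<beta> - \<beta>'\<bar>\<close>. The factor \<open>2\<close> accounts for the two ends of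
  the overlap.\<close>

lemma trapezoid_lipschitz:
  assumes "0 < k" "c \<in> codes k n"
  shows "\<bar>trapezoid k \<beta> \<sigma> c - trapezoid k \<beta>' \<sigma>' c\<bar> \<le> 2 * (\<bar>\<sigma> - \<sigma>'\<bar> + \<bar>\<beta> - \<beta>'\<bar>)"
proof -
  define a b s where "a = left_end k (fst c)" "b = left_end k (snd c)" "s = 1 / real k ^ n"
  have len: "length (fst c) = n" "length (snd c) = n" "set (snd c) \<subseteq> {..<k}"
    using assms by (auto simp: codes_def)
  have b: "0 \<le> b" "b + s \<le> 1" "0 \<le> s"
    using left_end_unit[OF \<open>0 < k\<close> len(3)] len by (auto simp: a_b_s_def)
  have lip: "\<bar>(\<sigma> - \<beta> * y) - (\<sigma>' - \<beta>' * y)\<bar> \<le> \<bar>\<sigma> - \<sigma>'\<bar> + \<bar>\<beta> - \<beta>'\<bar>" if "0 \<le> y" "y \<le> 1" for y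
  proof -
    have "(\<sigma> - \<beta> * y) - (\<sigma>' - \<beta>' * y) = (\<sigma> - \<sigma>') - (\<beta> - \<beta>') * y"
      by (simp add: algebra_simps)
    also have "\<bar>\<dots>\<bar> \<le> \<bar>\<sigma> - \<sigma>'\<bar> + \<bar>(\<beta> - \<beta>') * y\<bar>"
      by (rule abs_triangle_ineq4)
    also have "\<bar>(\<beta> - \<beta>') * y\<bar> \<le> \<bar>\<beta> - \<beta>'\<bar>"
      using that by (simp add: abs_mult mult_left_le)
    finally show ?thesis by simp
  qed
  define h h1 h' h1' where "h = \<sigma> - \<beta> * b" "h1 = \<sigma> - \<beta> * (b + s)" "h' = \<sigma>' - \<beta>' * b" "h1' = \<sigma>' - \<beta>' * (b + s)"
  define d where "d = \<bar>\<sigma> - \<sigma>'\<bar> + \<bar>\<beta> - \<beta>'\<bar>"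
  have "\<bar>h - h'\<bar> \<le> d" "\<bar>h1 - h1'\<bar> \<le> d"
    using lip[of b] lip[of "b + s"] b by (auto simp: h_h1_h'_h1'_def d_def)
  then have "\<bar>max h h1 - max h' h1'\<bar> \<le> d" "\<bar>min h h1 - min h' h1'\<bar> \<le> d"
    by (auto simp: max_def min_def abs_le_iff)
  then have "\<bar>max 0 (min (a + s) (max h h1) - max a (min h h1))
      - max 0 (min (a + s) (max h' h1') - max a (min h' h1'))\<bar> \<le> 2 * d"
    by (rule overlap_lipschitz)
  then show ?thesis
    by (simp add: trapezoid_def Let_def len h_h1_h'_h1'_def d_def flip: a_b_s_def)
qed

text \<open>Spares a discussion of which end points belong to a trace on a half-open cell, which
  depends on the sign of the slope.\<close>

lemma measure_lborel_between:
  fixes l u :: real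
  assumes "{l<..<u} \<subseteq> A" "A \<subseteq> {l..u}" "A \<in> sets borel"
  shows "measure lborel A = max 0 (u - l)"
proof -
  have "emeasure lborel A = ennreal (max 0 (u - l))"
  proof (rule antisym)
    have "emeasure lborel A \<le> emeasure lborel {l..u}"
      using assms by (intro emeasure_mono) auto
    then show "emeasure lborel A \<le> ennreal (max 0 (u - l))"
      by (simp add: emeasure_lborel_Icc_eq max_def split: if_splits)
    have "emeasure lborel {l<..<u} \<le> emeasure lborel A"
      using assms by (intro emeasure_mono) auto
    then show "ennreal (max 0 (u - l)) \<le> emeasure lborel A"
      by (cases "l \<le> u") (auto simp: max_def)
  qed
  then show ?thesis
    by (simp only: measure_def enn2real_ennreal max.cobounded1)
qed

lemma trace_length_slanted:
  assumes "0 < k" "\<beta> \<noteq> 0" "c \<in> codes k n"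
  shows "trace_length k (slanted_line \<beta> \<sigma>) c = trapezoid k \<beta> \<sigma> c"
proof -
  define a b s where "a = left_end k (fst c)" "b = left_end k (snd c)" "s = 1 / real k ^ n"
  have len: "length (fst c) = n" "length (snd c) = n"
    using assms by (auto simp: codes_def)
  define l u where "l = max a (min (\<sigma> - \<beta> * b) (\<sigma> - \<beta> * (b + s)))"
    "u = min (a + s) (max (\<sigma> - \<beta> * b) (\<sigma> - \<beta> * (b + s)))"
  let ?A = "slanted_line \<beta> \<sigma> -` half_open_cell k c"
  have A: "x \<in> ?A \<longleftrightarrow> a \<le> x \<and> x < a + s \<and> b \<le> (\<sigma> - x) / \<beta> \<and> (\<sigma> - x) / \<beta> < b + s" for x
    by (simp add: slanted_line_def half_open_cell_def half_open_interval_eq[OF \<open>0 < k\<close>] len a_b_s_def)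
  have "0 < s"
    using assms by (simp add: a_b_s_def)
  have "measure lborel ?A = max 0 (u - l)"
  proof (rule measure_lborel_between)
    show "?A \<in> sets borel"
      by (simp add: graph_like_vimage graph_like_slanted)
    \<comment> \<open>The abscissae at which the line crosses the bottom and the top of the cell;
      the sign of \<open>\<beta>\<close> decides their order.\<close>
    define g h where "g = \<sigma> - \<beta> * b" "h = \<sigma> - \<beta> * (b + s)"
    have slab: "b \<le> (\<sigma> - x) / \<beta> \<and> (\<sigma> - x) / \<beta> < b + s \<longleftrightarrow>
        (if 0 < \<beta> then x \<le> g \<and> h < x else g \<le> x \<and> x < h)" for x
      using \<open>\<beta> \<noteq> 0\<close>
      by (auto simp: g_h_def pos_le_divide_eq pos_divide_less_eq neg_le_divide_eq neg_divide_less_eq algebra_simps)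
    have "h < g" if "0 < \<beta>"
      using that \<open>0 < s\<close> by (simp add: g_h_def algebra_simps)
    moreover have "g < h" if "\<not> 0 < \<beta>"
      using that \<open>\<beta> \<noteq> 0\<close> \<open>0 < s\<close> by (simp add: g_h_def algebra_simps mult_less_0_iff)
    ultimately consider "0 < \<beta>" "max g h = g" "min g h = h" | "\<not> 0 < \<beta>" "max g h = h" "min g h = g"
      by (metis less_imp_le max.absorb1 max.absorb2 min.absorb1 min.absorb2)
    then show "{l<..<u} \<subseteq> ?A" "?A \<subseteq> {l..u}"
      unfolding subset_iff A slab l_u_def g_h_def[symmetric]
      by (cases; auto simp only: greaterThanLessThan_iff atLeastAtMost_iff max_less_iff_conj
        min_less_iff_conj max.bounded_iff min.bounded_iff if_True if_False intro: less_imp_le)+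
  qed
  then show ?thesis
    by (simp add: trace_length_def trapezoid_def Let_def len l_u_def flip: a_b_s_def)
qed

section \<open>From a finite grid of lines to all lines of bounded slope\<close>

lemma rational_grid_approximation:
  fixes x :: real and q N :: nat
  assumes "0 < q" "\<bar>x\<bar> \<le> real N"
  obtains i :: int where "i \<in> {- int (N * q)..int (N * q)}" "\<bar>x - of_int i / real q\<bar> \<le> 1 / real q"
proof
  let ?i = "\<lfloor>x * real q\<rfloor>"
  have "- real N * real q \<le> x * real q" "x * real q \<le> real N * real q"
    using assms mult_right_mono[of "- real N" x "real q"] by (auto simp: abs_le_iff intro!: mult_right_mono)
  then have "- int (N * q) \<le> ?i" "?i \<le> int (N * q)"
    by (auto simp: le_floor_iff floor_le_iff)
  then show "?i \<in> {- int (N * q)..int (N * q)}"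
    by simp
  have "x * real q - of_int ?i \<le> 1" "of_int ?i \<le> x * real q"
    by linarith+
  then have "\<bar>x * real q - of_int ?i\<bar> / real q \<le> 1 / real q"
    using assms by (intro divide_right_mono) auto
  moreover have "\<bar>x * real q - of_int ?i\<bar> / real q = \<bar>(x * real q - of_int ?i) / real q\<bar>"
    by simp
  moreover have "(x * real q - of_int ?i) / real q = x - of_int ?i / real q"
    using assms by (simp add: diff_divide_distrib)
  ultimately show "\<bar>x - of_int ?i / real q\<bar> \<le> 1 / real q"
    by simp
qed

lemma sum_trapezoid_lipschitz:
  assumes "0 < k" "A \<subseteq> codes k n" "\<bar>\<sigma> - \<sigma>'\<bar> + \<bar>\<beta> - \<beta>'\<bar> \<le> \<eta>"
  shows "\<bar>(\<Sum>c\<in>A. trapezoid k \<beta> \<sigma> c) - (\<Sum>c\<in>A. trapezoid k \<beta>' \<sigma>' c)\<bar> \<le> (real k ^ n)\<^sup>2 * (2 * \<eta>)"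
proof -
  have "0 \<le> \<eta>"
    using assms(3) by linarith
  have "\<bar>(\<Sum>c\<in>A. trapezoid k \<beta> \<sigma> c) - (\<Sum>c\<in>A. trapezoid k \<beta>' \<sigma>' c)\<bar>
      = \<bar>\<Sum>c\<in>A. trapezoid k \<beta> \<sigma> c - trapezoid k \<beta>' \<sigma>' c\<bar>"
    by (simp add: sum_subtractf)
  also have "\<dots> \<le> (\<Sum>c\<in>A. \<bar>trapezoid k \<beta> \<sigma> c - trapezoid k \<beta>' \<sigma>' c\<bar>)"
    by (rule sum_abs)
  also have "\<dots> \<le> (\<Sum>c\<in>A. 2 * \<eta>)"
    using assms by (intro sum_mono order_trans[OF trapezoid_lipschitz[where n = n]]) auto
  also have "\<dots> = real (card A) * (2 * \<eta>)"
    by simp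
  also have "\<dots> \<le> (real k ^ n)\<^sup>2 * (2 * \<eta>)"
  proof -
    have "card A \<le> (k ^ n)\<^sup>2"
      using card_mono[OF finite_codes assms(2)] by (simp add: card_codes)
    then have "real (card A) \<le> (real k ^ n)\<^sup>2"
      by (simp flip: of_nat_power)
    then show ?thesis
      using \<open>0 \<le> \<eta>\<close> by (intro mult_right_mono) auto
  qed
  finally show ?thesis .
qed

lemma half_open_cell_unit:
  assumes "c \<in> codes k n" "z \<in> half_open_cell k c"
  shows "0 \<le> fst z" "fst z < 1" "0 \<le> snd z" "snd z < 1"
  using assms half_open_interval_subset_unit[of "fst c" k "fst z"] half_open_interval_subset_unit[of "snd c" k "snd z"]
  by (auto simp: codes_def half_open_cell_def)

lemma trace_sum_eq_0:
  assumes "s n \<subseteq> codes k n" "\<And>x. \<not> (0 \<le> fst (L x) \<and> fst (L x) < 1 \<and> 0 \<le> snd (L x) \<and> snd (L x) < 1)"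
  shows "trace_sum k s n L = 0"
  unfolding trace_sum_def
proof (intro sum.neutral ballI)
  fix c assume "c \<in> s n"
  then have "c \<in> codes k n"
    using assms by auto
  then have "L -` half_open_cell k c = {}"
    using half_open_cell_unit[of c k n] assms(2) by blast
  then show "trace_length k L c = 0"
    by (simp add: trace_length_def)
qed

text \<open>The slope is bounded by \<open>N\<close> so that a finite grid suffices at each
  generation. The intercepts are then bounded as well: a line meeting the unit square has
  \<open>\<bar>\<sigma>\<bar> \<le> 1 + \<bar>\<beta>\<bar> \<le> N\<close>. The Lipschitz bound
  transfers the grid estimate to every line.\<close>

lemma (in fractal_percolation) AE_regular_trace_slanted:
  assumes "0 < p" "p \<le> 1" "0 < k" "0 < r" "r \<le> 1" "1 < r\<^sup>2 * (k * p)"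
  shows "AE \<omega> in M. \<exists>n0. \<forall>n\<ge>n0. \<forall>\<beta> \<sigma>. \<beta> \<noteq> 0 \<longrightarrow> \<bar>\<beta>\<bar> + 1 \<le> real N \<longrightarrow>
    regular_trace k p r (\<lambda>n. S n \<omega>) n (slanted_line \<beta> \<sigma>)"
proof -
  \<comment> \<open>The mesh is \<open>1 / Q ^ Suc n\<close>. Three grid errors add up to
    \<open>12 * (k\<^sup>2 / Q) ^ Suc n\<close>, and this choice of \<open>Q\<close> brings them
    below \<open>r ^ n * p * p ^ n\<close>.\<close>
  obtain Q :: nat where "max 1 (12 * (real k)\<^sup>2 / (r * p)) \<le> real Q"
    using real_arch_simple by blast
  then have Q: "1 \<le> Q" "12 * (real k)\<^sup>2 / (r * p) \<le> real Q"
    by auto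
  \<comment> \<open>Weights are cut off outside generation \<open>n + 1\<close>, because the
    concentration bound asks for \<open>w n j c \<le> 1 / k ^ Suc n\<close> at every code
    \<open>c\<close>.\<close>
  define w where "w n = (\<lambda>(i :: int, j :: int) c. if c \<in> codes k (Suc n)
      then trapezoid k (of_int i / real (Q ^ Suc n)) (of_int j / real (Q ^ Suc n)) c else 0)" for n
  define J where "J n = {- int (N * Q ^ Suc n)..int (N * Q ^ Suc n)} \<times> {- int (N * Q ^ Suc n)..int (N * Q ^ Suc n)}" for n
  have card_J: "real (card (J n)) \<le> ((2 * real N + 1) * real Q)\<^sup>2 * ((real Q)\<^sup>2) ^ n" for n
  proof -
    have "1 \<le> real Q ^ Suc n"
      using Q by (intro one_le_power) auto
    have "real (card (J n)) = (2 * real N * real Q ^ Suc n + 1)\<^sup>2"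
      by (simp add: J_def card_cartesian_product power2_eq_square mult.assoc)
    also have "\<dots> \<le> (2 * real N * real Q ^ Suc n + real Q ^ Suc n)\<^sup>2"
      using \<open>1 \<le> real Q ^ Suc n\<close> by (intro power_mono) auto
    also have "\<dots> = ((2 * real N + 1) * real Q)\<^sup>2 * ((real Q)\<^sup>2) ^ n"
      by (simp add: power2_eq_square power_mult_distrib algebra_simps)
    finally show ?thesis .
  qed
  have "AE \<omega> in M. \<exists>n0. \<forall>n\<ge>n0. \<forall>j\<in>J n.
    \<bar>(\<Sum>c\<in>S (Suc n) \<omega>. w n j c) - p * (\<Sum>c\<in>children k (S n \<omega>). w n j c)\<bar>
      \<le> r ^ n * p * max (p ^ n) (\<Sum>c\<in>children k (S n \<omega>). w n j c)"
  proof (rule AE_increments_le[OF \<open>0 < p\<close> \<open>0 < k\<close> \<open>0 < r\<close> \<open>1 < _\<close> _ card_J])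
    show "finite (J n)" for n
      by (simp add: J_def)
    show "0 \<le> w n j c" for n j c
      by (simp add: w_def trapezoid_nonneg split: prod.split)
    show "w n j c \<le> 1 / real k ^ Suc n" for n j c
      unfolding w_def by (auto intro!: trapezoid_le simp del: power_Suc split: prod.split)
  qed simp
  then show ?thesis
    using AE_space
  proof eventually_elim
    case (elim \<omega>)
    then obtain n0 where n0: "\<And>n j. n0 \<le> n \<Longrightarrow> j \<in> J n \<Longrightarrow>
      \<bar>(\<Sum>c\<in>S (Suc n) \<omega>. w n j c) - p * (\<Sum>c\<in>children k (S n \<omega>). w n j c)\<bar>
        \<le> r ^ n * p * max (p ^ n) (\<Sum>c\<in>children k (S n \<omega>). w n j c)"
      by blast
    let ?s = "\<lambda>n. S n \<omega>"
    have sub: "S n \<omega> \<subseteq> codes k n" for n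
      using elim retained_subset_codes by blast
    have "regular_trace k p r ?s n (slanted_line \<beta> \<sigma>)"
      if "n0 \<le> n" and \<beta>: "\<beta> \<noteq> 0" "\<bar>\<beta>\<bar> + 1 \<le> real N" for n \<beta> \<sigma>
    proof (cases "\<bar>\<sigma>\<bar> \<le> real N")
      case True
      define \<delta> where "\<delta> = (real k ^ Suc n)\<^sup>2 * (2 * (2 / real (Q ^ Suc n)))"
      have "0 < Q ^ Suc n" "\<bar>\<beta>\<bar> \<le> real N"
        using Q \<beta> by auto
      then obtain i j where ij: "i \<in> {- int (N * Q ^ Suc n)..int (N * Q ^ Suc n)}"
          "\<bar>\<beta> - of_int i / real (Q ^ Suc n)\<bar> \<le> 1 / real (Q ^ Suc n)"
          "j \<in> {- int (N * Q ^ Suc n)..int (N * Q ^ Suc n)}"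
          "\<bar>\<sigma> - of_int j / real (Q ^ Suc n)\<bar> \<le> 1 / real (Q ^ Suc n)"
        using rational_grid_approximation True by metis
      define T where "T A = (\<Sum>c\<in>A. trace_length k (slanted_line \<beta> \<sigma>) c)" for A
      define W where "W A = (\<Sum>c\<in>A. w n (i, j) c)" for A
      have close: "\<bar>T A - W A\<bar> \<le> \<delta>" if A: "A \<subseteq> codes k (Suc n)" for A
      proof -
        have "T A = (\<Sum>c\<in>A. trapezoid k \<beta> \<sigma> c)"
          unfolding T_def using A \<beta> \<open>0 < k\<close>
          by (intro sum.cong trace_length_slanted[where n = "Suc n"]) auto
        moreover have "W A = (\<Sum>c\<in>A. trapezoid k (of_int i / real (Q ^ Suc n)) (of_int j / real (Q ^ Suc n)) c)"
          unfolding W_def w_def using A by (intro sum.cong) auto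
        moreover have "2 / real (Q ^ Suc n) = 1 / real (Q ^ Suc n) + 1 / real (Q ^ Suc n)"
          by (simp only: add_divide_distrib[symmetric]) simp
        then have "\<bar>\<sigma> - of_int j / real (Q ^ Suc n)\<bar> + \<bar>\<beta> - of_int i / real (Q ^ Suc n)\<bar> \<le> 2 / real (Q ^ Suc n)"
          using ij(2,4) by linarith
        ultimately show ?thesis
          unfolding \<delta>_def using A \<open>0 < k\<close> by (simp only:) (rule sum_trapezoid_lipschitz)
      qed
      have T1: "trace_sum k ?s (Suc n) (slanted_line \<beta> \<sigma>) = T (S (Suc n) \<omega>)"
        by (simp add: trace_sum_def T_def)
      have T0: "trace_sum k ?s n (slanted_line \<beta> \<sigma>) = T (children k (S n \<omega>))"
        unfolding trace_sum_def T_def using sub \<open>0 < k\<close>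
        by (intro sum_children_trace_length[where n = n, symmetric] graph_like_slanted)
      have small: "3 * \<delta> \<le> r ^ n * p * p ^ n"
      proof -
        have rp: "0 < r * p"
          using assms by simp
        then have "(real k)\<^sup>2 / real Q \<le> r * p / 12"
          using Q by (simp add: field_simps)
        then have "((real k)\<^sup>2 / real Q) ^ Suc n \<le> (r * p / 12) ^ Suc n"
          by (intro power_mono) auto
        also have "\<dots> = (r * p) ^ Suc n / 12 ^ Suc n"
          by (rule power_divide)
        also have "\<dots> \<le> (r * p) ^ Suc n / 12"
          using rp by (intro divide_left_mono) auto
        finally have "12 * ((real k)\<^sup>2 / real Q) ^ Suc n \<le> (r * p) ^ Suc n"
          by linarith
        moreover have "3 * \<delta> = 12 * ((real k)\<^sup>2 / real Q) ^ Suc n"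
          unfolding \<delta>_def power_divide power_mult[symmetric] by (simp add: mult.commute)
        moreover have "(r * p) ^ Suc n \<le> r ^ n * p * p ^ n"
        proof -
          have "r * (r ^ n * p * p ^ n) \<le> 1 * (r ^ n * p * p ^ n)"
            using assms by (intro mult_right_mono) auto
          then show ?thesis by (simp add: power_mult_distrib mult_ac)
        qed
        ultimately show ?thesis by linarith
      qed
      let ?u = "T (S (Suc n) \<omega>)" and ?v = "T (children k (S n \<omega>))"
      let ?u' = "W (S (Suc n) \<omega>)" and ?v' = "W (children k (S n \<omega>))"
      have "0 \<le> \<delta>"
        by (simp add: \<delta>_def)
      have rn: "r ^ n \<le> 1" "0 < r ^ n"
        using assms by (auto intro: power_le_one)
      have u: "\<bar>?u - ?u'\<bar> \<le> \<delta>" and v: "\<bar>?v - ?v'\<bar> \<le> \<delta>"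
        using close[OF sub] close[OF children_subset_codes[OF sub]] by auto
      have "0 \<le> ?v"
        using trace_sum_nonneg[of k ?s n "slanted_line \<beta> \<sigma>"] by (simp add: T0)
      have "\<bar>?u' - p * ?v'\<bar> \<le> r ^ n * p * max (p ^ n) ?v'"
        unfolding W_def using n0[OF \<open>n0 \<le> n\<close>, of "(i, j)"] ij by (auto simp: J_def)
      also have "\<dots> \<le> r ^ n * p * (p ^ n + ?v + \<delta>)"
      proof (rule mult_left_mono)
        have "0 < p ^ n"
          using assms by simp
        then show "max (p ^ n) ?v' \<le> p ^ n + ?v + \<delta>"
          using v \<open>0 \<le> ?v\<close> \<open>0 \<le> \<delta>\<close> by linarith
      qed (use assms in simp)
      also have "\<dots> \<le> r ^ n * p * (p ^ n + ?v) + \<delta>"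
      proof -
        have "r ^ n * p * \<delta> \<le> 1 * \<delta>"
          using assms rn \<open>0 \<le> \<delta>\<close> by (intro mult_right_mono mult_le_one) auto
        then show ?thesis by (simp add: algebra_simps)
      qed
      finally have "\<bar>?u' - p * ?v'\<bar> \<le> r ^ n * p * (p ^ n + ?v) + \<delta>" .
      moreover have "p * \<bar>?v - ?v'\<bar> \<le> \<delta>"
        using assms v mult_mono[of p 1 "\<bar>?v - ?v'\<bar>" \<delta>] by simp
      then have "\<bar>p * ?v - p * ?v'\<bar> \<le> \<delta>"
        using assms by (simp add: abs_mult flip: right_diff_distrib)
      \<comment> \<open>One \<open>\<delta>\<close> for replacing \<open>?u\<close>, one for
        \<open>p * ?v\<close>, and one for \<open>?v'\<close> inside the maximum. Their total is
        absorbed by the second copy of \<open>p ^ n\<close> in \<open>regular_trace\<close>.\<close>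
      ultimately have "\<bar>?u - p * ?v\<bar> \<le> r ^ n * p * (p ^ n + ?v) + 3 * \<delta>"
        using u by linarith
      also have "\<dots> \<le> r ^ n * p * (?v + 2 * p ^ n)"
        using small by (simp add: algebra_simps)
      finally show ?thesis
        by (simp add: regular_trace_def T0 T1)
    next
      case False
      have "\<not> (0 \<le> x \<and> x < 1 \<and> 0 \<le> (\<sigma> - x) / \<beta> \<and> (\<sigma> - x) / \<beta> < 1)" for x
      proof
        assume *: "0 \<le> x \<and> x < 1 \<and> 0 \<le> (\<sigma> - x) / \<beta> \<and> (\<sigma> - x) / \<beta> < 1"
        have "\<sigma> = x + \<beta> * ((\<sigma> - x) / \<beta>)"
          using \<beta> by simp
        then have "\<bar>\<sigma>\<bar> \<le> \<bar>x\<bar> + \<bar>\<beta>\<bar> * \<bar>(\<sigma> - x) / \<beta>\<bar>"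
          by (metis abs_mult abs_triangle_ineq)
        also have "\<dots> \<le> 1 + \<bar>\<beta>\<bar> * 1"
          using * by (intro add_mono mult_left_mono) auto
        finally show False
          using False \<beta> by linarith
      qed
      then have "trace_sum k ?s m (slanted_line \<beta> \<sigma>) = 0" for m
        using sub by (intro trace_sum_eq_0) (auto simp: slanted_line_def)
      then show ?thesis
        using assms by (intro regular_trace_if_null)
    qed
    then show ?case by blast
  qed
qed

section \<open>The projected measures\<close>

lemma AE_lborel_coordinates_neq:
  fixes a :: real
  shows "AE z in lborel. fst (z :: real \<times> real) \<noteq> a" "AE z in lborel. snd (z :: real \<times> real) \<noteq> a"
proof -
  have "emeasure (lborel \<Otimes>\<^sub>M lborel) ({a} \<times> (UNIV :: real set)) = 0"
    "emeasure (lborel \<Otimes>\<^sub>M lborel) ((UNIV :: real set) \<times> {a}) = 0"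
    by (simp_all add: lborel.emeasure_pair_measure_Times)
  then have null: "{a} \<times> (UNIV :: real set) \<in> null_sets lborel" "(UNIV :: real set) \<times> {a} \<in> null_sets lborel"
    unfolding lborel_prod by (auto simp: null_sets_def intro!: borel_Times)
  show "AE z in lborel. fst (z :: real \<times> real) \<noteq> a"
    by (rule AE_I'[OF null(1)]) (auto simp: mem_Times_iff)
  show "AE z in lborel. snd (z :: real \<times> real) \<noteq> a"
    by (rule AE_I'[OF null(2)]) (auto simp: mem_Times_iff)
qed

text \<open>Closed cells overlap along edges, but they agree with the half-open ones off finitely
  many axis-parallel lines, which are null. The half-open cells are disjoint, so the indicator of
  their union is a sum.\<close>

lemma AE_indicator_generation_set:
  assumes "0 < k" "s n \<subseteq> codes k n"
  shows "AE z in lborel. indicator (generation_set k s n) z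
    = (\<Sum>c\<in>s n. indicator (half_open_cell k c) z :: ennreal)"
proof -
  have fin: "finite (s n)"
    using assms finite_subset finite_codes by blast
  have "AE z in lborel. \<forall>c\<in>s n. fst z \<noteq> left_end k (fst c) + 1 / real k ^ length (fst c)
      \<and> snd z \<noteq> left_end k (snd c) + 1 / real k ^ length (snd c)"
    by (intro AE_finite_allI[OF fin] AE_conjI AE_lborel_coordinates_neq)
  then show ?thesis
  proof eventually_elim
    case (elim z)
    have "z \<in> cell k c \<longleftrightarrow> z \<in> half_open_cell k c" if "c \<in> s n" for c
      using elim[rule_format, OF that]
      by (auto simp: cell_def adic_interval_def half_open_cell_def half_open_interval_eq[OF \<open>0 < k\<close>] mem_Times_iff add.commute)
    then have "indicator (generation_set k s n) z = (indicator (\<Union>c\<in>s n. half_open_cell k c) z :: ennreal)"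
      by (auto simp: generation_set_def indicator_def)
    also have "\<dots> = (\<Sum>c\<in>s n. indicator (half_open_cell k c) z)"
      by (intro indicator_UN_disjoint fin disjoint_family_on_mono[OF assms(2) half_open_cell_disjoint])
    finally show ?case .
  qed
qed

text \<open>Coordinates adapted to the projection: \<open>L t\<close> parametrizes the fibre over
  \<open>t\<close>, and \<open>\<kappa>\<close> is the constant Jacobian in Fubini's theorem. It
  also makes up for measuring traces in one coordinate.\<close>

definition line_chart :: "real \<Rightarrow> real \<Rightarrow> (real \<Rightarrow> real \<Rightarrow> real \<times> real) \<Rightarrow> bool" where
  "line_chart \<theta> \<kappa> L \<longleftrightarrow> 0 < \<kappa> \<and> (\<forall>t. graph_like (L t)) \<and> (\<forall>t x. proj \<theta> (L t x) = t)
    \<and> (\<lambda>(t, x). L t x) \<in> borel_measurable (lborel \<Otimes>\<^sub>M lborel)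
    \<and> (\<forall>g :: real \<times> real \<Rightarrow> ennreal. g \<in> borel_measurable borel \<longrightarrow>
      (\<integral>\<^sup>+z. g z \<partial>lborel) = ennreal \<kappa> * (\<integral>\<^sup>+t. \<integral>\<^sup>+x. g (L t x) \<partial>lborel \<partial>lborel))"

text \<open>For fixed \<open>x\<close>, substitute
  \<open>y = (t - x * cos \<theta>) / sin \<theta>\<close> and then exchange the integrals. The
  angle \<open>pi / 2\<close> is included and gives horizontal lines; in \<open>{0..<pi}\<close>
  only \<open>\<theta> = 0\<close> needs another chart.\<close>

lemma line_chart_oblique:
  assumes "0 < sin \<theta>"
  shows "line_chart \<theta> (1 / sin \<theta>) (\<lambda>t x. (x, (t - x * cos \<theta>) / sin \<theta>))"
  unfolding line_chart_def
proof (intro conjI allI impI)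
  show "0 < 1 / sin \<theta>"
    using assms by simp
  show "graph_like (\<lambda>x. (x, (t - x * cos \<theta>) / sin \<theta>))" for t
    by (simp add: graph_like_def borel_prod[symmetric])
  show "proj \<theta> (x, (t - x * cos \<theta>) / sin \<theta>) = t" for t x
    using assms by (simp add: proj_def)
  show "(\<lambda>(t, x). (x, (t - x * cos \<theta>) / sin \<theta>)) \<in> borel_measurable (lborel \<Otimes>\<^sub>M lborel)"
    unfolding borel_prod[symmetric] by measurable
  fix g :: "real \<times> real \<Rightarrow> ennreal"
  assume "g \<in> borel_measurable borel"
  then have [measurable]: "g \<in> borel_measurable (borel \<Otimes>\<^sub>M borel)"
    by (simp add: borel_prod)
  have "(\<integral>\<^sup>+z. g z \<partial>lborel) = (\<integral>\<^sup>+x. \<integral>\<^sup>+y. g (x, y) \<partial>lborel \<partial>lborel)"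
    unfolding lborel_prod[symmetric] by (rule lborel.nn_integral_fst[symmetric]) simp
  also have "\<dots> = (\<integral>\<^sup>+x. ennreal (1 / sin \<theta>) * (\<integral>\<^sup>+t. g (x, (t - x * cos \<theta>) / sin \<theta>) \<partial>lborel) \<partial>lborel)"
  proof (intro nn_integral_cong)
    fix x :: real
    have "(\<integral>\<^sup>+y. g (x, y) \<partial>lborel)
        = ennreal \<bar>1 / sin \<theta>\<bar> * (\<integral>\<^sup>+t. g (x, - x * cos \<theta> / sin \<theta> + 1 / sin \<theta> * t) \<partial>lborel)"
      using assms by (intro nn_integral_real_affine) auto
    also have "(\<lambda>t. - x * cos \<theta> / sin \<theta> + 1 / sin \<theta> * t) = (\<lambda>t. (t - x * cos \<theta>) / sin \<theta>)"
      by (simp add: fun_eq_iff diff_divide_distrib)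
    then have "(\<integral>\<^sup>+t. g (x, - x * cos \<theta> / sin \<theta> + 1 / sin \<theta> * t) \<partial>lborel)
        = (\<integral>\<^sup>+t. g (x, (t - x * cos \<theta>) / sin \<theta>) \<partial>lborel)"
      by metis
    finally show "(\<integral>\<^sup>+y. g (x, y) \<partial>lborel)
        = ennreal (1 / sin \<theta>) * (\<integral>\<^sup>+t. g (x, (t - x * cos \<theta>) / sin \<theta>) \<partial>lborel)"
      using assms by simp
  qed
  also have "\<dots> = ennreal (1 / sin \<theta>) * (\<integral>\<^sup>+x. \<integral>\<^sup>+t. g (x, (t - x * cos \<theta>) / sin \<theta>) \<partial>lborel \<partial>lborel)"
    by (intro nn_integral_cmult) simp
  also have "(\<integral>\<^sup>+x. \<integral>\<^sup>+t. g (x, (t - x * cos \<theta>) / sin \<theta>) \<partial>lborel \<partial>lborel)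
      = (\<integral>\<^sup>+t. \<integral>\<^sup>+x. g (x, (t - x * cos \<theta>) / sin \<theta>) \<partial>lborel \<partial>lborel)"
    by (rule lborel_pair.Fubini') simp
  finally show "(\<integral>\<^sup>+z. g z \<partial>lborel)
      = ennreal (1 / sin \<theta>) * (\<integral>\<^sup>+t. \<integral>\<^sup>+x. g (x, (t - x * cos \<theta>) / sin \<theta>) \<partial>lborel \<partial>lborel)" .
qed

lemma line_chart_vertical: "line_chart 0 1 (\<lambda>t x. (t, x))"
  unfolding line_chart_def
proof (intro conjI allI impI)
  fix g :: "real \<times> real \<Rightarrow> ennreal"
  assume "g \<in> borel_measurable borel"
  then have "g \<in> borel_measurable (lborel \<Otimes>\<^sub>M lborel)"
    by (simp add: lborel_prod)
  then show "(\<integral>\<^sup>+z. g z \<partial>lborel) = ennreal 1 * (\<integral>\<^sup>+t. \<integral>\<^sup>+x. g (t, x) \<partial>lborel \<partial>lborel)"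
    unfolding lborel_prod[symmetric] by (simp add: lborel.nn_integral_fst)
qed (auto simp: proj_def graph_like_vertical borel_prod[symmetric])

lemma nn_integral_indicator_graph:
  assumes "graph_like L" "A \<in> sets borel"
  shows "(\<integral>\<^sup>+x. indicator A (L x) \<partial>lborel) = emeasure lborel (L -` A)"
proof -
  have "(\<lambda>x. indicator A (L x) :: ennreal) = indicator (L -` A)"
    by (auto simp: fun_eq_iff indicator_def)
  then show ?thesis
    using graph_like_vimage[OF assms] by simp
qed

lemma trace_length_measurable:
  assumes "line_chart \<theta> \<kappa> L"
  shows "(\<lambda>t. trace_length k (L t) c) \<in> borel_measurable borel"
proof -
  have L: "(\<lambda>(t, x). L t x) \<in> borel_measurable (lborel \<Otimes>\<^sub>M lborel)"
    using assms by (simp add: line_chart_def)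
  have "(\<lambda>z. indicator (half_open_cell k c) (case z of (t, x) \<Rightarrow> L t x) :: ennreal)
      \<in> borel_measurable (lborel \<Otimes>\<^sub>M lborel)"
    using L by measurable
  then have "(\<lambda>t. \<integral>\<^sup>+x. indicator (half_open_cell k c) (L t x) \<partial>lborel) \<in> borel_measurable lborel"
    by (intro lborel.borel_measurable_nn_integral) (simp add: case_prod_beta')
  moreover have "(\<integral>\<^sup>+x. indicator (half_open_cell k c) (L t x) \<partial>lborel)
      = emeasure lborel (L t -` half_open_cell k c)" for t
    using assms by (intro nn_integral_indicator_graph) (simp_all add: line_chart_def)
  ultimately show ?thesis
    by (simp add: trace_length_def measure_def)
qed

lemma trace_sum_measurable:
  assumes "line_chart \<theta> \<kappa> L"
  shows "(\<lambda>t. trace_sum k s n (L t)) \<in> borel_measurable borel"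
  unfolding trace_sum_def using trace_length_measurable[OF assms] by (intro borel_measurable_sum)

lemma generation_set_borel: "finite (s n) \<Longrightarrow> generation_set k s n \<in> sets borel"
  unfolding generation_set_def cell_def adic_interval_def by (intro sets.finite_UN borel_Times) auto

lemma proj_continuous: "continuous_on A (proj \<theta>)"
  unfolding proj_def by (intro continuous_intros)

lemma proj_measurable [measurable]: "proj \<theta> \<in> borel_measurable borel"
  using proj_continuous by (rule borel_measurable_continuous_onI)

text \<open>On the fibre over \<open>t\<close> the test factor
  \<open>indicator A (proj \<theta> z)\<close> is constant, so the inner integral of the chart
  formula is the trace sum of \<open>L t\<close>.\<close>

lemma distr_proj_generation_set:
  assumes chart: "line_chart \<theta> \<kappa> L" and "0 < k" "s n \<subseteq> codes k n" "0 \<le> a"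
  shows "distr (density lborel (\<lambda>z. ennreal a * indicator (generation_set k s n) z)) borel (proj \<theta>)
    = density lborel (\<lambda>t. ennreal (a * \<kappa> * trace_sum k s n (L t)))" (is "?D = _")
proof (rule measure_eqI)
  fix A assume "A \<in> sets ?D"
  then have A [measurable]: "A \<in> sets borel"
    by simp
  have fin: "finite (s n)"
    using assms finite_subset finite_codes by blast
  note [measurable] = generation_set_borel[where s = s and n = n and k = k, OF fin] trace_sum_measurable[OF chart]
  let ?g = "\<lambda>z. ennreal a * (\<Sum>c\<in>s n. indicator (half_open_cell k c) z) * indicator A (proj \<theta> z)"
  have inner: "(\<integral>\<^sup>+x. ?g (L t x) \<partial>lborel) = ennreal (a * trace_sum k s n (L t)) * indicator A t" for t
  proof -
    have L: "graph_like (L t)" "\<And>x. proj \<theta> (L t x) = t"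
      using chart by (auto simp: line_chart_def)
    have [measurable]: "L t \<in> borel_measurable borel"
      using L by (simp add: graph_like_def)
    have "(\<integral>\<^sup>+x. ?g (L t x) \<partial>lborel)
        = ennreal a * (\<Sum>c\<in>s n. \<integral>\<^sup>+x. indicator (half_open_cell k c) (L t x) \<partial>lborel) * indicator A t"
      by (simp add: L nn_integral_multc nn_integral_cmult nn_integral_sum)
    also have "(\<Sum>c\<in>s n. \<integral>\<^sup>+x. indicator (half_open_cell k c) (L t x) \<partial>lborel)
        = (\<Sum>c\<in>s n. ennreal (trace_length k (L t) c))"
    proof (intro sum.cong)
      fix c assume "c \<in> s n"
      have "(\<integral>\<^sup>+x. indicator (half_open_cell k c) (L t x) \<partial>lborel) = emeasure lborel (L t -` half_open_cell k c)"
        using L by (intro nn_integral_indicator_graph) simp_all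
      also have "\<dots> = ennreal (trace_length k (L t) c)"
        using \<open>c \<in> s n\<close> assms L by (intro trace_length_bounds(1)) auto
      finally show "(\<integral>\<^sup>+x. indicator (half_open_cell k c) (L t x) \<partial>lborel) = ennreal (trace_length k (L t) c)" .
    qed simp
    also have "\<dots> = ennreal (trace_sum k s n (L t))"
      unfolding trace_sum_def by (intro sum_ennreal) (simp add: trace_length_def)
    finally show ?thesis
      using assms by (simp add: ennreal_mult trace_sum_nonneg)
  qed
  have "emeasure ?D A = (\<integral>\<^sup>+z. ennreal a * indicator (generation_set k s n) z * indicator A (proj \<theta> z) \<partial>lborel)"
    by (simp add: emeasure_distr emeasure_density measurable_sets_borel[OF proj_measurable A])
      (simp add: indicator_def)
  also have "\<dots> = (\<integral>\<^sup>+z. ?g z \<partial>lborel)"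
    using AE_indicator_generation_set[of k s n, OF \<open>0 < k\<close> assms(3)] by (intro nn_integral_cong_AE) (auto elim: eventually_mono)
  also have "\<dots> = ennreal \<kappa> * (\<integral>\<^sup>+t. \<integral>\<^sup>+x. ?g (L t x) \<partial>lborel \<partial>lborel)"
    using chart unfolding line_chart_def by (elim conjE allE impE) auto
  also have "\<dots> = (\<integral>\<^sup>+t. ennreal \<kappa> * (ennreal (a * trace_sum k s n (L t)) * indicator A t) \<partial>lborel)"
    unfolding inner by (rule nn_integral_cmult[symmetric]) measurable
  also have "\<dots> = (\<integral>\<^sup>+t. ennreal (a * \<kappa> * trace_sum k s n (L t)) * indicator A t \<partial>lborel)"
    using chart \<open>0 \<le> a\<close>
    by (intro nn_integral_cong) (simp add: line_chart_def ennreal_mult trace_sum_nonneg mult_ac)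
  also have "\<dots> = emeasure (density lborel (\<lambda>t. ennreal (a * \<kappa> * trace_sum k s n (L t)))) A"
    by (simp add: emeasure_density)
  finally show "emeasure ?D A = \<dots>" .
qed simp

lemma finite_borel_measure_eqI_continuous:
  fixes M N :: "real measure"
  assumes "finite_borel_measure M" "finite_borel_measure N"
    and eq: "\<And>f :: real \<Rightarrow> real. continuous_on UNIV f \<Longrightarrow> bounded (range f) \<Longrightarrow> (\<integral>x. f x \<partial>M) = (\<integral>x. f x \<partial>N)"
  shows "M = N"
proof (rule cdf_unique'[OF assms(1,2)], rule ext)
  fix a :: real
  interpret M: finite_borel_measure M by fact
  interpret N: finite_borel_measure N by fact
  \<comment> \<open>For \<open>n > 0\<close> a ramp equal to \<open>1\<close> up to \<open>a\<close>
    that falls linearly to \<open>0\<close> at \<open>a + 1 / n\<close>; the limit is the indicator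
    of \<open>{..a}\<close>, so the distribution functions agree.\<close>
  define u where "u n x = max 0 (min 1 (1 - real n * (x - a)))" for n x
  have u: "continuous_on UNIV (u n)" "\<bar>u n x\<bar> \<le> 1" for n x
    by (auto simp: u_def[abs_def] abs_if intro!: continuous_intros)
  have lim: "(\<lambda>n. u n x) \<longlonglongrightarrow> indicator {..a} x" for x
  proof (cases "x \<le> a")
    case True
    then have "u n x = 1" for n
      by (simp add: u_def mult_nonneg_nonpos)
    with True show ?thesis by simp
  next
    case False
    obtain m where m: "1 / (x - a) < real m"
      using reals_Archimedean2 by blast
    have "u n x = 0" if "m \<le> n" for n
    proof -
      have "1 < real m * (x - a)"
        using m False by (simp add: field_simps)
      also have "\<dots> \<le> real n * (x - a)"
        using that False by (intro mult_right_mono) auto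
      finally show ?thesis by (simp add: u_def)
    qed
    then have "\<forall>\<^sub>F n in sequentially. u n x = 0"
      by (auto simp: eventually_sequentially)
    with False show ?thesis
      by (simp add: tendsto_eventually)
  qed
  have conv: "(\<lambda>n. \<integral>x. u n x \<partial>K) \<longlonglongrightarrow> cdf K a" if "finite_borel_measure K" for K
  proof -
    interpret K: finite_borel_measure K by fact
    have [measurable]: "u n \<in> borel_measurable K" for n
      using borel_measurable_continuous_onI[OF u(1)[of n]] K.M_is_borel measurable_cong_sets by blast
    have "(\<lambda>n. \<integral>x. u n x \<partial>K) \<longlonglongrightarrow> (\<integral>x. indicator {..a} x \<partial>K)"
      by (rule integral_dominated_convergence[where w = "\<lambda>_. 1"]) (use u(2) lim K.M_is_borel in auto)
    then show ?thesis
      using K.M_is_borel by (simp add: cdf_def)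
  qed
  have "bounded (range (u n))" for n
    using u(2) by (intro boundedI[where B = 1]) auto
  then have "(\<integral>x. u n x \<partial>M) = (\<integral>x. u n x \<partial>N)" for n
    using u(1) by (intro eq) auto
  then show "cdf M a = cdf N a"
    using conv[OF assms(1)] conv[OF assms(2)] LIMSEQ_unique by simp
qed

text \<open>Test functions \<open>\<phi> (P z)\<close> reduce weak convergence to the line. There
  the densities are uniformly bounded with common bounded support, so dominated convergence
  identifies the limit.\<close>

lemma weak_limit_distr_density:
  fixes N :: "nat \<Rightarrow> 'a::topological_space measure" and P :: "'a \<Rightarrow> real"
  assumes wl: "weak_limit N \<mu>" and N: "\<And>n. sets (N n) = sets borel" and cont: "continuous_on UNIV P"
    and distr: "\<And>n. distr (N n) borel P = density lborel (\<lambda>t. ennreal (F n t))"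
    and F [measurable]: "\<And>n. F n \<in> borel_measurable borel"
    and F_nonneg: "\<And>n t. 0 \<le> F n t" and F_le: "\<And>n t. F n t \<le> b" and supp: "\<And>n t. R < \<bar>t\<bar> \<Longrightarrow> F n t = 0"
    and lim: "\<And>t. (\<lambda>n. F n t) \<longlonglongrightarrow> f t"
  shows "distr \<mu> borel P = density lborel (\<lambda>t. ennreal (f t))"
proof (rule finite_borel_measure_eqI_continuous)
  have \<mu>: "sets \<mu> = sets borel" "finite_measure \<mu>"
    using wl by (auto simp: weak_limit_def)
  have P_borel: "P \<in> borel_measurable borel"
    using cont by (rule borel_measurable_continuous_onI)
  have P_meas: "P \<in> borel_measurable \<mu>" "P \<in> borel_measurable (N n)" for n
    using P_borel measurable_cong_sets[OF \<mu>(1) refl] measurable_cong_sets[OF N refl] by blast+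
  have f [measurable]: "f \<in> borel_measurable borel"
    using lim F by (rule borel_measurable_LIMSEQ_real)
  have f_nonneg: "0 \<le> f t" for t
    using lim[of t] F_nonneg by (intro LIMSEQ_le_const) auto
  have f_le: "f t \<le> b" for t
    using lim[of t] F_le by (intro LIMSEQ_le_const2) auto
  have f_supp: "f t = 0" if "R < \<bar>t\<bar>" for t
    using lim[of t] supp[OF that] by (simp add: LIMSEQ_const_iff)
  have "0 \<le> b"
    using F_nonneg[of 0 0] F_le[of 0 0] by linarith
  show "finite_borel_measure (distr \<mu> borel P)"
    using finite_measure.finite_measure_distr[OF \<mu>(2) P_meas(1)]
    by (simp add: finite_borel_measure_def finite_borel_measure_axioms_def)
  have "finite_measure (density lborel (\<lambda>t. ennreal (f t)))"
  proof
    have "emeasure (density lborel (\<lambda>t. ennreal (f t))) UNIV = (\<integral>\<^sup>+t. ennreal (f t) \<partial>lborel)"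
      by (simp add: emeasure_density)
    also have "\<dots> \<le> (\<integral>\<^sup>+t. ennreal b * indicator {-R..R} t \<partial>lborel)"
      using f_le f_supp by (intro nn_integral_mono) (auto simp: indicator_def abs_le_iff ennreal_leI not_le)
    also have "\<dots> = ennreal b * emeasure lborel {-R..R}"
      by (simp add: nn_integral_cmult_indicator)
    also have "\<dots> < \<infinity>"
      by (simp add: ennreal_mult_less_top emeasure_lborel_Icc_eq)
    finally show "emeasure (density lborel (\<lambda>t. ennreal (f t))) (space (density lborel (\<lambda>t. ennreal (f t)))) \<noteq> \<infinity>"
      by simp
  qed
  then show "finite_borel_measure (density lborel (\<lambda>t. ennreal (f t)))"
    by (simp add: finite_borel_measure_def finite_borel_measure_axioms_def)
  fix \<phi> :: "real \<Rightarrow> real"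
  assume \<phi>: "continuous_on UNIV \<phi>" "bounded (range \<phi>)"
  have [measurable]: "\<phi> \<in> borel_measurable borel"
    using \<phi>(1) by (rule borel_measurable_continuous_onI)
  obtain B where B: "\<And>x. \<bar>\<phi> x\<bar> \<le> B"
    using \<phi>(2) by (auto simp: bounded_iff)
  have "continuous_on UNIV (\<lambda>z. \<phi> (P z))"
    using continuous_on_compose2[OF \<phi>(1) cont] by simp
  moreover have "bounded (range (\<lambda>z. \<phi> (P z)))"
    using B by (intro boundedI[where B = B]) auto
  ultimately have "(\<lambda>n. \<integral>z. \<phi> (P z) \<partial>N n) \<longlonglongrightarrow> (\<integral>z. \<phi> (P z) \<partial>\<mu>)"
    using wl unfolding weak_limit_def by blast
  moreover have "(\<integral>z. \<phi> (P z) \<partial>N n) = (\<integral>t. F n t * \<phi> t \<partial>lborel)" for n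
  proof -
    have "(\<integral>z. \<phi> (P z) \<partial>N n) = (\<integral>t. \<phi> t \<partial>distr (N n) borel P)"
      using P_meas(2) by (intro integral_distr[symmetric]) auto
    also have "\<dots> = (\<integral>t. F n t * \<phi> t \<partial>lborel)"
      unfolding distr using F_nonneg by (subst integral_density) auto
    finally show ?thesis .
  qed
  ultimately have "(\<lambda>n. \<integral>t. F n t * \<phi> t \<partial>lborel) \<longlonglongrightarrow> (\<integral>z. \<phi> (P z) \<partial>\<mu>)"
    by simp
  moreover have "(\<lambda>n. \<integral>t. F n t * \<phi> t \<partial>lborel) \<longlonglongrightarrow> (\<integral>t. f t * \<phi> t \<partial>lborel)"
  proof (rule integral_dominated_convergence[where w = "\<lambda>t. b * B * indicator {-R..R} t"])
    show "integrable lborel (\<lambda>t. b * B * indicator {-R..R} t)"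
      by (intro integrable_mult_right integrable_real_indicator) (auto simp: emeasure_lborel_Icc_eq)
    show "AE t in lborel. (\<lambda>n. F n t * \<phi> t) \<longlonglongrightarrow> f t * \<phi> t"
      by (intro AE_I2 tendsto_intros lim)
    show "AE t in lborel. norm (F n t * \<phi> t) \<le> b * B * indicator {-R..R} t" for n
    proof (rule AE_I2)
      fix t
      show "norm (F n t * \<phi> t) \<le> b * B * indicator {-R..R} t"
      proof (cases "R < \<bar>t\<bar>")
        case False
        then have "t \<in> {-R..R}"
          by auto
        moreover have "F n t * \<bar>\<phi> t\<bar> \<le> b * B"
          using F_nonneg F_le B \<open>0 \<le> b\<close> by (intro mult_mono) auto
        ultimately show ?thesis
          using F_nonneg[of n t] by (simp add: abs_mult)
      next
        case True
        then have "t \<notin> {-R..R}"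
          by auto
        with True show ?thesis
          by (simp add: supp)
      qed
    qed
  qed auto
  ultimately have "(\<integral>z. \<phi> (P z) \<partial>\<mu>) = (\<integral>t. f t * \<phi> t \<partial>lborel)"
    by (rule LIMSEQ_unique)
  then show "(\<integral>t. \<phi> t \<partial>distr \<mu> borel P) = (\<integral>t. \<phi> t \<partial>density lborel (\<lambda>t. ennreal (f t)))"
    using P_meas(1) f_nonneg by (subst integral_distr) (auto simp: integral_density)
qed

text \<open>
  Convergence in \<open>percolation_Z\<close> is never used: if that limit does not exist, \<open>percolation_Z\<close> is an
  arbitrary real number, and if this number is not positive, the natural measure is null and \<open>a = 0\<close>.
\<close>

lemma is_density_projected:
  fixes L :: "real \<Rightarrow> real \<Rightarrow> real \<times> real"
  assumes chart: "line_chart \<theta> \<kappa> L" and "0 < k" "0 < p" and r: "0 < r" "r < 1" and s: "\<And>n. s n \<subseteq> codes k n"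
    and rate: "\<And>n t. \<bar>trace_sum k s n (L t) / p ^ n - f t\<bar> \<le> C * r ^ n"
    and \<mu>: "is_natural_measure k p s \<mu>"
  shows "\<exists>a. is_density (projected \<theta> \<mu>) (\<lambda>t. a * f t)"
proof
  define a where "a = max 0 (1 / percolation_Z k p s)"
  have L: "graph_like (L t)" "\<And>x. proj \<theta> (L t x) = t" for t
    using chart by (auto simp: line_chart_def)
  have "0 < \<kappa>"
    using chart by (simp add: line_chart_def)
  have "0 \<le> a"
    by (simp add: a_def)
  let ?X = "\<lambda>n t. trace_sum k s n (L t) / p ^ n"
  have X_nonneg: "0 \<le> ?X n t" for n t
    using \<open>0 < p\<close> by (simp add: trace_sum_nonneg)
  have lim: "(\<lambda>n. ?X n t) \<longlonglongrightarrow> f t" for t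
  proof -
    have "(\<lambda>n. C * r ^ n) \<longlonglongrightarrow> 0"
      using r by (intro tendsto_mult_right_zero LIMSEQ_power_zero) auto
    then have "(\<lambda>n. ?X n t - f t) \<longlonglongrightarrow> 0"
      by (rule Lim_null_comparison[rotated]) (use rate in simp)
    then show ?thesis
      by (simp add: LIM_zero_iff)
  qed
  have "0 \<le> C"
    using rate[of 0 0] by simp
  \<comment> \<open>\<open>?X 0\<close> is at most \<open>1\<close>, and both \<open>?X 0\<close>
    and \<open>?X n\<close> lie within \<open>C\<close> of \<open>f\<close>.\<close>
  have X_le: "?X n t \<le> 1 + 2 * C" for n t
  proof -
    have "?X 0 t \<le> 1"
      using trace_sum_le[OF \<open>0 < k\<close> L(1), of s 0] s by simp
    moreover have "C * r ^ n \<le> C"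
      using r \<open>0 \<le> C\<close> by (intro mult_left_le power_le_one) auto
    ultimately show ?thesis
      using rate[of 0 t] rate[of n t] by simp
  qed
  have f_nonneg: "0 \<le> f t" for t
    using lim[of t] X_nonneg by (intro LIMSEQ_le_const) auto
  have X_meas [measurable]: "?X n \<in> borel_measurable borel" for n
    using trace_sum_measurable[OF chart] by measurable
  have "f \<in> borel_measurable borel"
    using lim X_meas by (rule borel_measurable_LIMSEQ_real)
  then have f_meas [measurable]: "(\<lambda>t. a * \<kappa> * f t) \<in> borel_measurable borel"
    by measurable
  have "distr \<mu> borel (proj \<theta>) = density lborel (\<lambda>t. ennreal (a * \<kappa> * f t))"
  proof (rule weak_limit_distr_density)
    show "weak_limit (natural_approx k p s) \<mu>"
      using \<mu> by (simp add: is_natural_measure_def)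
    show "sets (natural_approx k p s n) = sets borel" for n
      by (simp add: natural_approx_def)
    show "continuous_on UNIV (proj \<theta>)"
      by (rule proj_continuous)
    show "distr (natural_approx k p s n) borel (proj \<theta>) = density lborel (\<lambda>t. ennreal (a * \<kappa> * ?X n t))" for n
    proof -
      have "ennreal (1 / (p ^ n * percolation_Z k p s)) = ennreal (a / p ^ n)"
      proof (cases "0 < percolation_Z k p s")
        case True
        then show ?thesis by (simp add: a_def mult.commute)
      next
        case False
        then have "1 / (p ^ n * percolation_Z k p s) \<le> 0" "a = 0"
          using \<open>0 < p\<close> by (auto simp: a_def divide_le_0_iff mult_le_0_iff)
        then show ?thesis by (simp add: ennreal_neg)
      qed
      then show ?thesis
        unfolding natural_approx_def
        using distr_proj_generation_set[where s = s and n = n, OF chart \<open>0 < k\<close> s, of "a / p ^ n"] \<open>0 < p\<close> \<open>0 \<le> a\<close>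
        by (simp add: mult_ac)
    qed
    show "(\<lambda>t. a * \<kappa> * ?X n t) \<in> borel_measurable borel" for n
      by measurable
    show "0 \<le> a * \<kappa> * ?X n t" for n t
      using \<open>0 \<le> a\<close> \<open>0 < \<kappa>\<close> by (intro mult_nonneg_nonneg X_nonneg) auto
    show "a * \<kappa> * ?X n t \<le> a * \<kappa> * (1 + 2 * C)" for n t
      using \<open>0 \<le> a\<close> \<open>0 < \<kappa>\<close> X_le by (intro mult_left_mono) auto
    \<comment> \<open>A line through the unit square has \<open>\<bar>t\<bar> \<le> \<bar>cos
      \<theta>\<bar> + \<bar>sin \<theta>\<bar> \<le> 2\<close>.\<close>
    show "a * \<kappa> * ?X n t = 0" if "2 < \<bar>t\<bar>" for n t
    proof -
      have "\<bar>t\<bar> \<le> 2" if "0 \<le> fst (L t x)" "fst (L t x) < 1" "0 \<le> snd (L t x)" "snd (L t x) < 1" for x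
      proof -
        have "\<bar>t\<bar> \<le> \<bar>fst (L t x)\<bar> * \<bar>cos \<theta>\<bar> + \<bar>snd (L t x)\<bar> * \<bar>sin \<theta>\<bar>"
          using L(2)[of t x] abs_triangle_ineq[of "fst (L t x) * cos \<theta>" "snd (L t x) * sin \<theta>"]
          by (simp add: proj_def abs_mult)
        also have "\<dots> \<le> 1 * 1 + 1 * 1"
          using that by (intro add_mono mult_mono) auto
        finally show ?thesis by simp
      qed
      then have "trace_sum k s n (L t) = 0"
        using s \<open>2 < \<bar>t\<bar>\<close> by (intro trace_sum_eq_0) force+
      then show ?thesis by simp
    qed
    show "(\<lambda>n. a * \<kappa> * ?X n t) \<longlonglongrightarrow> a * \<kappa> * f t" for t
      by (intro tendsto_intros lim)
  qed
  then show "is_density (projected \<theta> \<mu>) (\<lambda>t. a * \<kappa> * f t)"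
    using f_meas f_nonneg \<open>0 \<le> a\<close> \<open>0 < \<kappa>\<close> by (simp add: is_density_def projected_def)
qed

section \<open>Hoelder continuous densities for a fixed realization\<close>

lemma holder_on_cmult:
  assumes "holder_on d A f"
  shows "holder_on d A (\<lambda>t. a * f t)"
proof -
  obtain C \<alpha> where C: "0 < \<alpha>" "\<alpha> \<le> 1" "\<And>x y. x \<in> A \<Longrightarrow> y \<in> A \<Longrightarrow> \<bar>f x - f y\<bar> \<le> C * d x y powr \<alpha>"
    using assms unfolding holder_on_def by blast
  have "\<bar>a * f x - a * f y\<bar> \<le> \<bar>a\<bar> * C * d x y powr \<alpha>" if "x \<in> A" "y \<in> A" for x y
    using mult_left_mono[OF C(3)[OF that], of "\<bar>a\<bar>"] by (simp add: mult.assoc flip: abs_mult right_diff_distrib)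
  with C show ?thesis
    unfolding holder_on_def by blast
qed

lemma is_density_absolutely_continuous:
  assumes "is_density \<nu> f"
  shows "absolutely_continuous lborel \<nu>"
  using assms by (auto simp: is_density_def intro: absolutely_continuousI_density)

lemma holder_density_oblique:
  assumes "0 < p" "p \<le> 1" "2 \<le> k" and r: "0 < r" "r < 1" and s: "\<And>n. s n \<subseteq> codes k n"
    and "0 < sin \<theta>" "cos \<theta> \<noteq> 0" and \<mu>: "is_natural_measure k p s \<mu>"
    and reg: "\<And>n \<sigma>. n0 \<le> n \<Longrightarrow> regular_trace k p r s n (slanted_line (tan \<theta>) \<sigma>)"
  shows "\<exists>f. is_density (projected \<theta> \<mu>) f \<and> holder_on dist UNIV f"
proof -
  define L where "L t = slanted_line (tan \<theta>) (t / cos \<theta>)" for t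
  have "0 < k" "tan \<theta> \<noteq> 0"
    using assms by (auto simp: tan_def)
  have "L = (\<lambda>t x. (x, (t - x * cos \<theta>) / sin \<theta>))"
    using assms by (auto simp: L_def slanted_line_def fun_eq_iff tan_def field_simps)
  then have chart: "line_chart \<theta> (1 / sin \<theta>) L"
    using line_chart_oblique assms by simp
  obtain C f where rate: "\<And>n t. \<bar>trace_sum k s n (L t) / p ^ n - f t\<bar> \<le> C * r ^ n"
    using regular_traces_uniform_limit[OF \<open>0 < p\<close> \<open>0 < k\<close> r, of L s n0] reg s
    by (auto simp: L_def graph_like_slanted)
  have "holder_on dist UNIV f"
  proof (rule holder_of_geometric_approximation[OF r _ rate])
    have "1 \<le> (real k)\<^sup>2"
      using \<open>0 < k\<close> by (intro one_le_power) auto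
    then have "p \<le> (real k)\<^sup>2"
      using \<open>p \<le> 1\<close> by linarith
    then show "1 \<le> (real k)\<^sup>2 / p"
      using \<open>0 < p\<close> by simp
    \<comment> \<open>At most \<open>k ^ (2 * n)\<close> cells, each with Lipschitz constant
      \<open>2\<close> in \<open>t / cos \<theta>\<close>, and the normalization
      \<open>p ^ n\<close>. The constant may blow up near \<open>pi / 2\<close>, since it is allowed
      to depend on the angle.\<close>
    show "\<bar>trace_sum k s n (L x) / p ^ n - trace_sum k s n (L t) / p ^ n\<bar>
        \<le> 2 / \<bar>cos \<theta>\<bar> * ((real k)\<^sup>2 / p) ^ n * \<bar>x - t\<bar>" for n x t
    proof -
      have eq: "trace_sum k s n (L t) = (\<Sum>c\<in>s n. trapezoid k (tan \<theta>) (t / cos \<theta>) c)" for t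
        unfolding trace_sum_def L_def using s \<open>0 < k\<close> \<open>tan \<theta> \<noteq> 0\<close>
        by (intro sum.cong trace_length_slanted[where n = n]) auto
      have "\<bar>trace_sum k s n (L x) - trace_sum k s n (L t)\<bar>
          \<le> (real k ^ n)\<^sup>2 * (2 * \<bar>x / cos \<theta> - t / cos \<theta>\<bar>)"
        unfolding eq using \<open>0 < k\<close> s by (intro sum_trapezoid_lipschitz) auto
      then have "\<bar>trace_sum k s n (L x) - trace_sum k s n (L t)\<bar> / p ^ n
          \<le> (real k ^ n)\<^sup>2 * (2 * \<bar>x / cos \<theta> - t / cos \<theta>\<bar>) / p ^ n"
        using \<open>0 < p\<close> by (intro divide_right_mono) auto
      moreover have "\<bar>trace_sum k s n (L x) - trace_sum k s n (L t)\<bar> / p ^ n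
          = \<bar>trace_sum k s n (L x) / p ^ n - trace_sum k s n (L t) / p ^ n\<bar>"
        using \<open>0 < p\<close> by (simp flip: diff_divide_distrib)
      moreover have "(real k ^ n)\<^sup>2 * (2 * \<bar>x / cos \<theta> - t / cos \<theta>\<bar>) / p ^ n
          = 2 / \<bar>cos \<theta>\<bar> * ((real k)\<^sup>2 / p) ^ n * \<bar>x - t\<bar>"
        by (simp add: power_divide flip: diff_divide_distrib power_mult) (simp add: mult.commute)
      ultimately show ?thesis by simp
    qed
    show "\<bar>trace_sum k s 0 (L t) / p ^ 0\<bar> \<le> 1" for t
      using trace_sum_le[OF \<open>0 < k\<close>, of "L t" s 0] trace_sum_nonneg[of k s 0 "L t"] s
      by (simp add: L_def graph_like_slanted)
  qed
  then show ?thesis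
    using is_density_projected[OF chart \<open>0 < k\<close> \<open>0 < p\<close> r s rate \<mu>] holder_on_cmult by blast
qed

lemma holder_density_axis:
  fixes q :: "code \<Rightarrow> nat list"
  assumes "0 < p" "2 \<le> k" and r: "0 < r" "r < 1" "1 / k \<le> r" and s: "\<And>n. s n \<subseteq> codes k n"
    and chart: "line_chart \<theta> \<kappa> L" and \<mu>: "is_natural_measure k p s \<mu>"
    and trace: "\<And>n c t. c \<in> codes k n \<Longrightarrow> trace_length k (L t) c =
      (if \<lfloor>t * real k ^ n\<rfloor> = int (word_index k (q c)) then 1 / real k ^ n else 0)"
    and reg: "\<And>n t. n0 \<le> n \<Longrightarrow> regular_trace k p r s n (L t)"
  shows "\<exists>f. is_density (projected \<theta> \<mu>) f \<and> holder_on (adic_dist k) ({0..1} - adic_points k) f"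
proof -
  have "0 < k"
    using assms by simp
  have "graph_like (L t)" for t
    using chart by (simp add: line_chart_def)
  then obtain C f where rate: "\<And>n t. \<bar>trace_sum k s n (L t) / p ^ n - f t\<bar> \<le> C * r ^ n"
    using regular_traces_uniform_limit[OF \<open>0 < p\<close> \<open>0 < k\<close> r(1,2), of L s n0] reg s by blast
  have "holder_on (adic_dist k) ({0..1} - adic_points k) f"
  proof (rule holder_adic_of_geometric_approximation[OF r \<open>2 \<le> k\<close> rate])
    fix n and x t :: real
    assume *: "\<lfloor>x * real k ^ n\<rfloor> = \<lfloor>t * real k ^ n\<rfloor>"
    have "trace_sum k s n (L x) = trace_sum k s n (L t)"
      unfolding trace_sum_def
    proof (rule sum.cong)
      fix c assume "c \<in> s n"
      then have "c \<in> codes k n"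
        using s by blast
      then show "trace_length k (L x) c = trace_length k (L t) c"
        by (simp add: trace *)
    qed simp
    then show "trace_sum k s n (L x) / p ^ n = trace_sum k s n (L t) / p ^ n"
      by simp
  qed
  then show ?thesis
    using is_density_projected[OF chart \<open>0 < k\<close> \<open>0 < p\<close> r(1,2) s rate \<mu>] holder_on_cmult by blast
qed

theorem theorem2p1:
  fixes M :: "'w measure" and k :: nat and p :: real and S :: "nat \<Rightarrow> 'w \<Rightarrow> code set"
  assumes "k \<ge> 2" and "0 < p" and "p < 1" and "real k * p > 1"
    and "fractal_percolation M k p S"
  shows "AE \<omega> in M. percolation_fractal k (\<lambda>n. S n \<omega>) \<noteq> {} \<longrightarrow>
    (\<forall>\<mu>. is_natural_measure k p (\<lambda>n. S n \<omega>) \<mu> \<longrightarrow>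
      (\<forall>\<theta>\<in>{0..<pi}. absolutely_continuous lborel (projected \<theta> \<mu>)) \<and>
      (\<forall>\<theta>\<in>{0..<pi} - {0, pi / 2}.
         \<exists>f. is_density (projected \<theta> \<mu>) f \<and> holder_on dist UNIV f) \<and>
      (\<forall>\<theta>\<in>{0, pi / 2}.
         \<exists>f. is_density (projected \<theta> \<mu>) f \<and>
             holder_on (adic_dist k) ({0..1} - adic_points k) f))"
proof -
  interpret fractal_percolation M k p S by fact
  \<comment> \<open>Then \<open>r\<^sup>2 * (k * p)\<close> is the square root of
    \<open>k * p\<close>; any exponent strictly between \<open>- 1 / 2\<close> and \<open>0\<close>
    would serve. As \<open>p < 1\<close>, also \<open>1 / k \<le> 1 / (k * p) \<le> r\<close>, which
    is needed for the metric on non-adic points.\<close>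
  define r where "r = (real k * p) powr (- 1 / 4)"
  have "0 < k"
    using assms by simp
  have r: "0 < r" "r < 1"
    using assms by (auto simp: r_def powr_less_one)
  have "r\<^sup>2 * (k * p) = (real k * p) powr (- 1 / 4) * (real k * p) powr (- 1 / 4) * (real k * p) powr 1"
    using assms by (simp add: r_def power2_eq_square)
  also have "\<dots> = (real k * p) powr (1 / 2)"
    by (simp only: powr_add[symmetric]) simp
  finally have rkp: "1 < r\<^sup>2 * (k * p)"
    using assms by (simp add: gr_one_powr)
  have "1 / k \<le> (real k * p) powr (- 1)"
    using assms by (simp add: powr_minus_divide field_simps)
  also have "\<dots> \<le> r"
    unfolding r_def using assms by (intro powr_mono) auto
  finally have kr: "1 / k \<le> r" .
  have h: "AE \<omega> in M. \<exists>n0. \<forall>n\<ge>n0. \<forall>t. regular_trace k p r (\<lambda>n. S n \<omega>) n (\<lambda>x. (x, t))"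
    using assms \<open>0 < k\<close> r rkp trace_length_horizontal graph_like_horizontal
    by (intro AE_regular_trace_axis[where q = snd]) auto
  have v: "AE \<omega> in M. \<exists>n0. \<forall>n\<ge>n0. \<forall>t. regular_trace k p r (\<lambda>n. S n \<omega>) n (\<lambda>x. (t, x))"
    using assms \<open>0 < k\<close> r rkp trace_length_vertical graph_like_vertical
    by (intro AE_regular_trace_axis[where q = fst]) auto
  \<comment> \<open>Slopes are unbounded near \<open>pi / 2\<close>; a countable union of null sets
    over the bounds \<open>N\<close> covers all of them. The threshold \<open>n0\<close> may depend
    on \<open>N\<close>, hence on the angle.\<close>
  have "AE \<omega> in M. \<forall>N. \<exists>n0. \<forall>n\<ge>n0. \<forall>\<beta> \<sigma>. \<beta> \<noteq> 0 \<longrightarrow> \<bar>\<beta>\<bar> + 1 \<le> real N \<longrightarrow>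
      regular_trace k p r (\<lambda>n. S n \<omega>) n (slanted_line \<beta> \<sigma>)"
    unfolding AE_all_countable using assms \<open>0 < k\<close> r rkp by (intro allI AE_regular_trace_slanted) auto
  with h v show ?thesis
    using AE_space
  proof eventually_elim
    case (elim \<omega>)
    let ?s = "\<lambda>n. S n \<omega>"
    have s: "?s n \<subseteq> codes k n" for n
      using elim retained_subset_codes by blast
    show ?case
    proof (intro impI allI)
      fix \<mu> assume \<mu>: "is_natural_measure k p ?s \<mu>"
      have oblique: "\<exists>f. is_density (projected \<theta> \<mu>) f \<and> holder_on dist UNIV f"
        if \<theta>: "\<theta> \<in> {0..<pi} - {0, pi / 2}" for \<theta>
      proof -
        have "0 < sin \<theta>"
          using \<theta> by (intro sin_gt_zero) auto
        have "cos \<theta> \<noteq> 0"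
        proof
          assume "cos \<theta> = 0"
          then have "\<theta> = pi / 2"
            using \<theta> cos_inj_pi[of \<theta> "pi / 2"] by auto
          with \<theta> show False by simp
        qed
        obtain N :: nat where N: "\<bar>tan \<theta>\<bar> + 1 \<le> real N"
          using real_arch_simple by blast
        have "tan \<theta> \<noteq> 0"
          using \<open>0 < sin \<theta>\<close> \<open>cos \<theta> \<noteq> 0\<close> by (simp add: tan_def)
        then obtain n0 where "\<And>n \<sigma>. n0 \<le> n \<Longrightarrow> regular_trace k p r ?s n (slanted_line (tan \<theta>) \<sigma>)"
          using elim(3) N by blast
        with \<open>0 < sin \<theta>\<close> \<open>cos \<theta> \<noteq> 0\<close> show ?thesis
          using assms r s \<mu> by (intro holder_density_oblique[of p k r ?s \<theta> \<mu> n0]) auto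
      qed
      have axis: "\<exists>f. is_density (projected \<theta> \<mu>) f \<and> holder_on (adic_dist k) ({0..1} - adic_points k) f"
        if "\<theta> \<in> {0, pi / 2}" for \<theta>
      proof (cases "\<theta> = 0")
        case True
        obtain n0 where "\<And>n t. n0 \<le> n \<Longrightarrow> regular_trace k p r ?s n (\<lambda>x. (t, x))"
          using elim(2) by blast
        with True show ?thesis
          using holder_density_axis[OF \<open>0 < p\<close> \<open>2 \<le> k\<close> r kr s line_chart_vertical \<mu>, of fst n0]
            trace_length_vertical[OF \<open>0 < k\<close>] by auto
      next
        case False
        then have \<theta>: "\<theta> = pi / 2"
          using that by simp
        \<comment> \<open>At \<open>pi / 2\<close> the sine is \<open>1\<close> and the cosine
          \<open>0\<close>, so the oblique chart consists of horizontal lines.\<close>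
        have chart: "line_chart \<theta> 1 (\<lambda>t x. (x, t))"
          using line_chart_oblique[of \<theta>] by (simp add: \<theta>)
        obtain n0 where "\<And>n t. n0 \<le> n \<Longrightarrow> regular_trace k p r ?s n (\<lambda>x. (x, t))"
          using elim(1) by blast
        then show ?thesis
          using holder_density_axis[OF \<open>0 < p\<close> \<open>2 \<le> k\<close> r kr s chart \<mu>, of snd n0]
            trace_length_horizontal[OF \<open>0 < k\<close>] by auto
      qed
      have "absolutely_continuous lborel (projected \<theta> \<mu>)" if "\<theta> \<in> {0..<pi}" for \<theta>
        using that oblique[of \<theta>] axis[of \<theta>] is_density_absolutely_continuous by blast
      with oblique axis show "(\<forall>\<theta>\<in>{0..<pi}. absolutely_continuous lborel (projected \<theta> \<mu>)) \<and>
        (\<forall>\<theta>\<in>{0..<pi} - {0, pi / 2}.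
           \<exists>f. is_density (projected \<theta> \<mu>) f \<and> holder_on dist UNIV f) \<and>
        (\<forall>\<theta>\<in>{0, pi / 2}.
           \<exists>f. is_density (projected \<theta> \<mu>) f \<and>
               holder_on (adic_dist k) ({0..1} - adic_points k) f)"
        by blast
    qed
  qed
qed

end
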